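(* Let $A_1=\{x_1=0\}$ and $A_2=\{x_2=0\}$ be the coordinate axes in $\mathbb{R}^2$. The following holds for rotational $(-\alpha)$-homogeneous solutions with $\rho\equiv0$ of the stationary inviscid Boussinesq equations (i.e. stationary 2D Euler solutions) having both the $x_1$-symmetry and the $x_2$-symmetry. (i) For every $-1<\alpha<0$, solutions $(u,p)\in C^\infty(\mathbb{R}^2\setminus(A_1\cup A_2))\cap C(\mathbb{R}^2)$ exist. (ii) For every $0<\alpha<1$, solutions $(u,p)\in C^\infty(\mathbb{R}^2\setminus(A_1\cup A_2))$ exist. The solutions in (i) are weak solutions in $\mathbb{R}^2$, and the $C^1$-norm of $u$ diverges on $A_1\cup A_2$. Their velocity $u$ is $(-\alpha)$-Hölder continuous in the radial variable and $\left(2+\frac{2}{\alpha-1}\right)$-Hölder continuous in the angular variable. The solutions in (ii) satisfy the equations in $\mathbb{R}^2\setminus(A_1\cup A_2)$, and the velocity $u$ diverges on $A_1\cup A_2$.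
   Context: With $\rho\equiv0$ the stationary inviscid Boussinesq equations for $u=(u^1,u^2)$ and $p$ are the stationary Euler equations $$u\cdot\nabla u+\nabla p=0,\qquad \nabla\cdot u=0.$$ For $\alpha\in\mathbb{R}$, $(u,p)$ is $(-\alpha)$-homogeneous if $u(x)=|x|^{-\alpha}u(x/|x|)$ and $p(x)=|x|^{-2\alpha}p(x/|x|)$. $x_1$-symmetry: $u^1(x_1,x_2)=-u^1(-x_1,x_2)$, $u^2(x_1,x_2)=u^2(-x_1,x_2)$, $p(x_1,x_2)=p(-x_1,x_2)$. $x_2$-symmetry: $u^1(x_1,x_2)=u^1(x_1,-x_2)$, $u^2(x_1,x_2)=-u^2(x_1,-x_2)$, $p(x_1,x_2)=p(x_1,-x_2)$. Rotational means that the vorticity $\omega=\partial_1u^2-\partial_2u^1$ is not identically zero (off the axes). Weak solution in $\mathbb{R}^2$ means: $\int_{\mathbb{R}^2}\big((u\cdot\nabla\varphi)\cdot u+p\,\nabla\cdot\varphi\big)dx=0$ for all vector fields $\varphi\in C^1_c(\mathbb{R}^2)$, and $\nabla\cdot u=0$ in the sense of distributions. "The $C^1$-norm of $u$ diverges" (resp. "$u$ diverges") on a set of axes means that $|u|+|\nabla u|$ (resp. $|u|$), computed off the axes, is unbounded near every point of those axes other than the origin. Hölder continuity in the radial and angular variables refers to polar coordinates $(r,\phi)$: $u=r^{-\alpha}U(\phi)$, with $r\mapsto r^{-\alpha}$ being $(-\alpha)$-Hölder on $[0,\infty)$ and $U$ Hölder on $\mathbb{S}^1$ with the stated exponent. 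*)

theory Defs
  imports "HOL-Analysis.Analysis"
begin

definition axis1 :: "(real^2) set"
  where "axis1 = {x. x $ 1 = 0}"

definition axis2 :: "(real^2) set"
  where "axis2 = {x. x $ 2 = 0}"

abbreviation off_axes :: "(real^2) set"
  where "off_axes \<equiv> - (axis1 \<union> axis2)"

text \<open>Regularity on an open set, by recursion on directional derivatives.\<close>

fun Ck_on :: "nat \<Rightarrow> ('a::real_normed_vector \<Rightarrow> 'b::real_normed_vector) \<Rightarrow> 'a set \<Rightarrow> bool"
  where
    "Ck_on 0 f S \<longleftrightarrow> continuous_on S f"
  | "Ck_on (Suc n) f S \<longleftrightarrow> (\<forall>x\<in>S. f differentiable (at x)) \<and>
       (\<forall>v. Ck_on n (\<lambda>x. frechet_derivative f (at x) v) S)"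

definition Cinf_on :: "('a::real_normed_vector \<Rightarrow> 'b::real_normed_vector) \<Rightarrow> 'a set \<Rightarrow> bool"
  where "Cinf_on f S \<longleftrightarrow> (\<forall>n. Ck_on n f S)"

definition compactly_supported :: "('a::topological_space \<Rightarrow> 'b::zero) \<Rightarrow> bool"
  where "compactly_supported f \<longleftrightarrow> compact (closure {x. f x \<noteq> 0})"

definition pd :: "2 \<Rightarrow> (real^2 \<Rightarrow> 'b::real_normed_vector) \<Rightarrow> real^2 \<Rightarrow> 'b"
  where "pd j f x = frechet_derivative f (at x) (axis j 1)"

definition grad :: "(real^2 \<Rightarrow> real) \<Rightarrow> real^2 \<Rightarrow> real^2"
  where "grad f x = (\<chi> j. pd j f x)"

definition divergence :: "(real^2 \<Rightarrow> real^2) \<Rightarrow> real^2 \<Rightarrow> real"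
  where "divergence v x = (\<Sum>j\<in>UNIV. pd j v x $ j)"

text \<open>\<open>advect u v\<close> is the vector field $u \cdot \nabla v$.\<close>

definition advect :: "(real^2 \<Rightarrow> real^2) \<Rightarrow> (real^2 \<Rightarrow> real^2) \<Rightarrow> real^2 \<Rightarrow> real^2"
  where "advect u v x = (\<Sum>j\<in>UNIV. (u x $ j) *\<^sub>R pd j v x)"

definition vorticity :: "(real^2 \<Rightarrow> real^2) \<Rightarrow> real^2 \<Rightarrow> real"
  where "vorticity u x = pd 1 u x $ 2 - pd 2 u x $ 1"

definition rotational :: "(real^2 \<Rightarrow> real^2) \<Rightarrow> bool"
  where "rotational u \<longleftrightarrow> (\<exists>x\<in>off_axes. vorticity u x \<noteq> 0)"

definition euler_on :: "(real^2) set \<Rightarrow> (real^2 \<Rightarrow> real^2) \<Rightarrow> (real^2 \<Rightarrow> real) \<Rightarrow> bool"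
  where "euler_on S u p \<longleftrightarrow> (\<forall>x\<in>S. advect u u x + grad p x = 0 \<and> divergence u x = 0)"

text \<open>\<open>has_bochner_integral\<close> makes integrability part of the notion; the Bochner integral of a
  non-integrable function is \<open>0\<close> by convention.\<close>

definition weak_euler :: "(real^2 \<Rightarrow> real^2) \<Rightarrow> (real^2 \<Rightarrow> real) \<Rightarrow> bool"
  where "weak_euler u p \<longleftrightarrow>
    (\<forall>\<phi>::real^2 \<Rightarrow> real^2. Ck_on 1 \<phi> UNIV \<and> compactly_supported \<phi> \<longrightarrow>
       has_bochner_integral lborel (\<lambda>x. advect u \<phi> x \<bullet> u x + p x * divergence \<phi> x) 0) \<and>
    (\<forall>\<eta>::real^2 \<Rightarrow> real. Cinf_on \<eta> UNIV \<and> compactly_supported \<eta> \<longrightarrow>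
       has_bochner_integral lborel (\<lambda>x. u x \<bullet> grad \<eta> x) 0)"

text \<open>The domain \<open>D\<close> below is the set where \<open>(u, p)\<close> is regarded as defined. It is
  either the whole plane or the complement of the axes, both invariant under the reflections
  and (away from the origin) under scaling.\<close>

definition homogeneous_on ::
    "(real^2) set \<Rightarrow> real \<Rightarrow> (real^2 \<Rightarrow> real^2) \<Rightarrow> (real^2 \<Rightarrow> real) \<Rightarrow> bool"
  where "homogeneous_on D \<alpha> u p \<longleftrightarrow>
    (\<forall>x\<in>D - {0}. u x = (norm x powr (- \<alpha>)) *\<^sub>R u (x /\<^sub>R norm x) \<and>
                 p x = (norm x powr (- 2 * \<alpha>)) * p (x /\<^sub>R norm x))"

definition x1_symmetric_on ::
    "(real^2) set \<Rightarrow> (real^2 \<Rightarrow> real^2) \<Rightarrow> (real^2 \<Rightarrow> real) \<Rightarrow> bool"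
  where "x1_symmetric_on D u p \<longleftrightarrow>
    (\<forall>x\<in>D. let y = vector [- (x $ 1), x $ 2] in
       u x $ 1 = - (u y $ 1) \<and> u x $ 2 = u y $ 2 \<and> p x = p y)"

definition x2_symmetric_on ::
    "(real^2) set \<Rightarrow> (real^2 \<Rightarrow> real^2) \<Rightarrow> (real^2 \<Rightarrow> real) \<Rightarrow> bool"
  where "x2_symmetric_on D u p \<longleftrightarrow>
    (\<forall>x\<in>D. let y = vector [x $ 1, - (x $ 2)] in
       u x $ 1 = u y $ 1 \<and> u x $ 2 = - (u y $ 2) \<and> p x = p y)"

text \<open>Rotational $(-\alpha)$-homogeneous solutions off the axes with both symmetries.\<close>

definition symmetric_solution ::
    "(real^2) set \<Rightarrow> real \<Rightarrow> (real^2 \<Rightarrow> real^2) \<Rightarrow> (real^2 \<Rightarrow> real) \<Rightarrow> bool"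
  where "symmetric_solution D \<alpha> u p \<longleftrightarrow>
    Cinf_on u off_axes \<and> Cinf_on p off_axes \<and> euler_on off_axes u p \<and> rotational u \<and>
    homogeneous_on D \<alpha> u p \<and> x1_symmetric_on D u p \<and> x2_symmetric_on D u p"

text \<open>\<open>g\<close>, computed off the axes, is unbounded near every nonzero point of the axes.\<close>

definition diverges_on_axes :: "(real^2 \<Rightarrow> real) \<Rightarrow> bool"
  where "diverges_on_axes g \<longleftrightarrow>
    (\<forall>a\<in>(axis1 \<union> axis2) - {0}. \<forall>e>0. \<forall>M. \<exists>x\<in>off_axes. dist x a < e \<and> \<bar>g x\<bar> > M)"

definition holder_on :: "real \<Rightarrow> 'a::metric_space set \<Rightarrow> ('a \<Rightarrow> 'b::metric_space) \<Rightarrow> bool"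
  where "holder_on \<gamma> S f \<longleftrightarrow> 0 < \<gamma> \<and> \<gamma> \<le> 1 \<and>
    (\<exists>C. \<forall>x\<in>S. \<forall>y\<in>S. dist (f x) (f y) \<le> C * dist x y powr \<gamma>)"

definition polar :: "real \<Rightarrow> real \<Rightarrow> real^2"
  where "polar r \<phi> = vector [r * cos \<phi>, r * sin \<phi>]"

text \<open>Polar form $u = r^{-\alpha} U(\phi)$ with radial exponent \<open>\<gamma>\<close> and angular exponent
  \<open>\<delta>\<close>. The representation forces \<open>U\<close> to be $2\pi$-periodic, so that Hoelder
  continuity on the line is Hoelder continuity on the circle. Case \<open>r = 0\<close>: Isabelle's
  \<open>0 powr (- \<alpha>)\<close> is \<open>0\<close>, the right value of $r^{-\alpha}$ for \<open>\<alpha> < 0\<close>.\<close>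

definition polar_holder :: "real \<Rightarrow> (real^2 \<Rightarrow> real^2) \<Rightarrow> real \<Rightarrow> real \<Rightarrow> bool"
  where "polar_holder \<alpha> u \<gamma> \<delta> \<longleftrightarrow>
    (\<exists>U::real \<Rightarrow> real^2.
       (\<forall>r\<ge>0. \<forall>\<phi>. u (polar r \<phi>) = (r powr (- \<alpha>)) *\<^sub>R U \<phi>) \<and>
       holder_on \<gamma> {0..} (\<lambda>r::real. r powr (- \<alpha>)) \<and> holder_on \<delta> UNIV U)"

end

(* A stationary flow with radial pressure p = P r^(2k-2), k = 1 - alpha, is sought with stream
   function r^k f(phi).  The angular momentum equation is then automatic and the radial one is a
   second-order equation for f with a first integral.  Taking f = h for alpha < 0 and f = |h|^k sgn h
   for alpha > 0, both cases become
     h'^2 = m^2 (1 - h^2) + b (1 - |h|^beta),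
   and h = sin theta turns this into theta' = w(theta) with w positive, even and pi-periodic.  The
   intermediate value theorem gives b > 0 for which theta gains pi in time pi/2; then h is odd and
   changes sign under the shift by pi/2, which yields both reflection symmetries at once.  The
   zeros of h lie on the axes, and there f'' (for alpha < 0) or f' (for alpha > 0) blows up. *)
theory Submission
  imports Defs
begin

section \<open>Calculus in the plane and smooth functions\<close>

text \<open>Regard E = f'^2 as a function of f. The radial equation is then linear of first order in
  E, solved by a constant minus k^2 f^2 plus a multiple of |f|^(2 - 2/k). Hence beta = 2 - 2/k = 2 +
  2/(alpha - 1) and m = k, with max |f| normalised to 1. For 0 < k < 1 that exponent is negative;
  putting f = |h|^k sgn h and dividing by k^2 |h|^(2k - 2) exchanges the constant and the singular
  term, which leaves m = 1 and beta = 2 - 2k = 2 alpha.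

  For b = 0 the solution is h = sin (m y), whose half-period pi / m exceeds pi / 2 as long as m < 2;
  for alpha < 0 this is alpha > -1. A positive b shortens the half-period.

  Two obstacles shape the proof. The equation for h degenerates at |h| = 1, and |h|^beta is not
  Lipschitz at 0 when beta < 1; so theta is the inverse of a time integral, not a Picard limit. For
  alpha < 0 the gradient of u is unbounded at the axes, so the weak form rests on the continuity of
  the fluxes across them.\<close>

lemma vec2_eq_iff: "x = y \<longleftrightarrow> x $ 1 = y $ 1 \<and> x $ 2 = y $ 2" for x y :: "'a^2"
  by (simp add: vec_eq_iff forall_2)

lemma inner_vec2: "x \<bullet> y = x $ 1 * y $ 1 + x $ 2 * y $ 2" for x y :: "real^2"
  by (simp add: inner_vec_def sum_2)

lemma norm_vec2: "(norm x)\<^sup>2 = (x $ 1)\<^sup>2 + (x $ 2)\<^sup>2" for x :: "real^2"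
  unfolding power2_norm_eq_inner inner_vec2 by (simp add: power2_eq_square)

lemma has_derivative_nth2: "((\<lambda>x::real^2. x $ i) has_derivative (\<lambda>v. v $ i)) F"
  by (rule bounded_linear_imp_has_derivative[OF bounded_linear_vec_nth])

lemma continuous_on_vector2:
  fixes f g :: "'a::topological_space \<Rightarrow> real"
  assumes "continuous_on S f" "continuous_on S g"
  shows "continuous_on S (\<lambda>x. vector [f x, g x] :: real^2)"
proof -
  have "(\<lambda>x. vector [f x, g x] :: real^2) = (\<lambda>x. f x *\<^sub>R axis 1 1 + g x *\<^sub>R axis 2 1)"
    by (auto simp: vec2_eq_iff axis_def)
  then show ?thesis using assms by (simp only:) (auto intro!: continuous_intros)
qed

lemma has_derivative_vector2:
  fixes f g :: "'a::real_normed_vector \<Rightarrow> real"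
  assumes "(f has_derivative f') F" "(g has_derivative g') F"
  shows "((\<lambda>x. vector [f x, g x] :: real^2) has_derivative (\<lambda>v. vector [f' v, g' v])) F"
proof -
  have *: "(\<lambda>x. vector [f x, g x] :: real^2) = (\<lambda>x. f x *\<^sub>R axis 1 1 + g x *\<^sub>R axis 2 1)" for f g :: "'b \<Rightarrow> real"
    by (auto simp: vec2_eq_iff axis_def)
  show ?thesis unfolding * using assms by (auto intro!: derivative_eq_intros)
qed

lemma open_off_axes: "open off_axes"
proof -
  have "off_axes = {x. x $ 1 \<noteq> 0} \<inter> {x. x $ 2 \<noteq> (0::real)}"
    by (auto simp: axis1_def axis2_def)
  moreover have "open {x::real^2. x $ i \<noteq> 0}" for i
    by (intro open_Collect_neq continuous_intros)
  ultimately show ?thesis by auto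
qed

lemma off_axes_iff: "x \<in> off_axes \<longleftrightarrow> x $ 1 \<noteq> 0 \<and> x $ 2 \<noteq> 0"
  by (auto simp: axis1_def axis2_def)

text \<open>Openness of \<open>S\<close> turns agreement on \<open>S\<close> into agreement of
  germs, so the derivatives \<open>at x\<close> agree too and the induction can descend.\<close>

lemma Ck_on_cong:
  assumes "open S" "\<And>x. x \<in> S \<Longrightarrow> f x = g x"
  shows "Ck_on n f S = Ck_on n g S"
  using assms(2)
proof (induction n arbitrary: f g)
  case 0
  then show ?case by (simp cong: continuous_on_cong)
next
  case (Suc n)
  have *: "(f has_derivative D) (at x) \<longleftrightarrow> (g has_derivative D) (at x)" if "x \<in> S" for x D
    using has_derivative_transform_within_open[OF _ assms(1) that, of f D UNIV g]
      has_derivative_transform_within_open[OF _ assms(1) that, of g D UNIV f] Suc.prems by auto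
  then have "f differentiable (at x) \<longleftrightarrow> g differentiable (at x)" if "x \<in> S" for x
    using that by (simp add: differentiable_def)
  moreover have fd: "frechet_derivative f (at x) v = frechet_derivative g (at x) v" if "x \<in> S" for x v
    using that * by (simp add: frechet_derivative_def)
  moreover from fd have "Ck_on n (\<lambda>x. frechet_derivative f (at x) v) S
      = Ck_on n (\<lambda>x. frechet_derivative g (at x) v) S" for v
    by (intro Suc.IH) blast
  ultimately show ?case by (simp only: Ck_on.simps) blast
qed

text \<open>Avoids any formula for higher derivatives: a class of functions that is closed under
  directional derivatives can contain only smooth ones. The algebra \<open>flow_alg\<close> is built
  for this use.\<close>

lemma Cinf_on_coinduct:
  assumes "open S" and "P f"
    and step: "\<And>f. P f \<Longrightarrow> \<exists>D. (\<forall>x\<in>S. (f has_derivative D x) (at x)) \<and> (\<forall>v. P (\<lambda>x. D x v))"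
  shows "Cinf_on f S"
proof -
  have "Ck_on n f S" if "P f" for n f
    using that
  proof (induction n arbitrary: f)
    case 0
    from step[OF 0] obtain D where "\<forall>x\<in>S. (f has_derivative D x) (at x)" by blast
    then show ?case
      by (auto intro!: continuous_at_imp_continuous_on has_derivative_continuous)
  next
    case (Suc n)
    from step[OF Suc.prems] obtain D where D: "\<forall>x\<in>S. (f has_derivative D x) (at x)" "\<forall>v. P (\<lambda>x. D x v)"
      by blast
    have "Ck_on n (\<lambda>x. frechet_derivative f (at x) v) S" for v
    proof -
      have "Ck_on n (\<lambda>x. D x v) S" using Suc.IH D(2) by blast
      moreover have "D x v = frechet_derivative f (at x) v" if "x \<in> S" for x
        using D(1) that frechet_derivative_at by metis
      ultimately show ?thesis
        by (subst Ck_on_cong[OF \<open>open S\<close>, where g = "\<lambda>x. D x v"]) auto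
    qed
    moreover have "\<forall>x\<in>S. f differentiable (at x)" using D(1) by (auto simp: differentiable_def)
    ultimately show ?case by simp
  qed
  with \<open>P f\<close> show ?thesis by (simp add: Cinf_on_def)
qed

lemma pd_eqI: "(f has_derivative D) (at x) \<Longrightarrow> pd j f x = D (axis j 1)"
  unfolding pd_def using frechet_derivative_at by metis

text \<open>Without \<open>sgn x\<close> the derivative is again a norm power times an inner
  product, the shape that closure under differentiation needs. On the real line the same rule
  differentiates \<open>\<bar>x\<bar> powr s\<close>.\<close>

lemma has_derivative_norm_powr:
  fixes x :: "'a::real_inner"
  assumes "x \<noteq> 0"
  shows "((\<lambda>x. norm x powr s) has_derivative (\<lambda>v. s * norm x powr (s - 2) * (x \<bullet> v))) (at x)"
proof -
  have n: "norm x > 0" using assms by simp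
  have "((\<lambda>r. r powr s) has_real_derivative s * norm x powr (s - 1)) (at (norm x))"
    using n by (auto intro!: derivative_eq_intros)
  then have "((\<lambda>r. r powr s) has_derivative (\<lambda>d. (s * norm x powr (s - 1)) * d)) (at (norm x))"
    by (simp add: has_field_derivative_def)
  from has_derivative_compose[OF has_derivative_norm[OF assms] this]
  have "((\<lambda>x. norm x powr s) has_derivative (\<lambda>v. s * norm x powr (s - 1) * (v \<bullet> sgn x))) (at x)" .
  moreover have "norm x powr (s - 1) * (v \<bullet> sgn x) = norm x powr (s - 2) * (x \<bullet> v)" for v
  proof -
    have "norm x powr (s - 1) = norm x powr (s - 2) * norm x"
      using n powr_add[of "norm x" "s - 2" 1] by simp
    then show ?thesis using n by (simp add: sgn_div_norm inner_commute)
  qed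
  ultimately show ?thesis by (simp add: mult.assoc)
qed

section \<open>A concave secant slope and a periodic clock\<close>

text \<open>Concavity. For z > 0, Young's inequality with weights \<gamma> and 1 - \<gamma> bounds
  z^\<gamma> x^(1 - \<gamma>); dividing by the second factor gives the tangent at
  \<open>x\<close>.\<close>

lemma powr_le_tangent:
  fixes x z \<gamma> :: real
  assumes "0 < x" "0 \<le> z" "0 < \<gamma>" "\<gamma> < 1"
  shows "z powr \<gamma> \<le> x powr \<gamma> + \<gamma> * x powr (\<gamma> - 1) * (z - x)"
proof (cases "z = 0")
  case True
  have "x powr (\<gamma> - 1) * x = x powr \<gamma>"
    using assms by (simp add: powr_mult_base mult.commute)
  then show ?thesis
    using assms True by (simp add: mult.assoc)
next
  case False
  have 1: "x powr (\<gamma> - 1) * x = x powr \<gamma>"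
    using assms by (simp add: powr_mult_base mult.commute)
  have 2: "x powr (1 - \<gamma>) * x powr (\<gamma> - 1) = 1"
    using assms by (simp flip: powr_add)
  have "z powr \<gamma> * x powr (1 - \<gamma>) \<le> \<gamma> * z + (1 - \<gamma>) * x"
    using assms False by (intro Youngs_inequality_0) auto
  then have "z powr \<gamma> * x powr (1 - \<gamma>) * x powr (\<gamma> - 1)
      \<le> (\<gamma> * z + (1 - \<gamma>) * x) * x powr (\<gamma> - 1)"
    by (intro mult_right_mono) auto
  then have "z powr \<gamma> \<le> \<gamma> * z * x powr (\<gamma> - 1) + (1 - \<gamma>) * (x powr (\<gamma> - 1) * x)"
    using 2 by (simp add: algebra_simps)
  then show ?thesis
    using 1 by (simp add: algebra_simps)
qed

text \<open>After scaling to a + b = 1 this is c \<le> c^\<gamma> on [0, 1], applied to both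
  summands.\<close>

lemma powr_add_le:
  fixes a b \<gamma> :: real
  assumes "0 \<le> a" "0 \<le> b" "0 < \<gamma>" "\<gamma> \<le> 1"
  shows "(a + b) powr \<gamma> \<le> a powr \<gamma> + b powr \<gamma>"
proof (cases "a + b = 0")
  case True
  then show ?thesis using assms by simp
next
  case False
  have *: "c \<le> c powr \<gamma>" if "0 \<le> c" "c \<le> 1" for c :: real
  proof (cases "c = 0")
    case False
    then show ?thesis using that assms powr_mono'[of \<gamma> 1 c] by simp
  qed simp
  define s where "s = a + b"
  have s: "s > 0" using False assms by (auto simp: s_def)
  have "1 = a / s + b / s" using s by (simp add: s_def flip: add_divide_distrib)
  also have "\<dots> \<le> (a / s) powr \<gamma> + (b / s) powr \<gamma>"
    using s assms by (intro add_mono *) (auto simp: s_def)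
  also have "\<dots> = (a powr \<gamma> + b powr \<gamma>) / s powr \<gamma>"
    using s assms by (simp add: powr_divide add_divide_distrib)
  finally show ?thesis using s by (simp add: s_def field_simps)
qed

lemma abs_powr_diff_le:
  fixes a b \<gamma> :: real
  assumes "0 \<le> a" "0 \<le> b" "0 < \<gamma>" "\<gamma> \<le> 1"
  shows "\<bar>a powr \<gamma> - b powr \<gamma>\<bar> \<le> \<bar>a - b\<bar> powr \<gamma>"
proof (cases "a \<le> b")
  case True
  then show ?thesis
    using powr_add_le[of a "b - a" \<gamma>] assms powr_mono2[of \<gamma> a b] by (auto simp: abs_if)
next
  case False
  then show ?thesis
    using powr_add_le[of b "a - b" \<gamma>] assms powr_mono2[of \<gamma> b a] by (auto simp: abs_if)
qed

text \<open>The chord slope of x^\<gamma> between x and 1, with its limit as the value at 1. For x =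
  h^2 and \<gamma> = \<beta> / 2 it divides out the zero that 1 - |h|^\<beta> has at the turning
  points |h| = 1.\<close>

definition secant :: "real \<Rightarrow> real \<Rightarrow> real"
  where "secant \<gamma> x = (if x = 1 then \<gamma> else (1 - x powr \<gamma>) / (1 - x))"

lemma secant_mult: "secant \<gamma> x * (1 - x) = 1 - x powr \<gamma>"
  by (simp add: secant_def)

lemma secant_ge:
  assumes "0 < \<gamma>" "\<gamma> < 1" "0 \<le> x" "x \<le> 1"
  shows "\<gamma> \<le> secant \<gamma> x"
  using powr_le_tangent[of 1 x \<gamma>] assms by (auto simp: secant_def field_simps)

text \<open>By concavity the chord slope decreases. It is only as rough as x^\<gamma> near 0 and is
  Lipschitz away from 0, although its denominator vanishes at 1; hence the split at 1/2.\<close>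

lemma secant_diff_le:
  fixes x y \<gamma> :: real
  assumes \<gamma>: "0 < \<gamma>" "\<gamma> < 1" and xy: "0 \<le> x" "x < y" "y \<le> 1"
  shows "\<bar>secant \<gamma> x - secant \<gamma> y\<bar> \<le> 2 * (y powr \<gamma> - x powr \<gamma>) + 2 * (y - x)"
proof -
  define d where "d = y powr \<gamma> - x powr \<gamma>"
  have x1: "x < 1" using xy by simp
  have d0: "0 \<le> d" using assms by (simp add: d_def powr_mono2)
  have eq: "secant \<gamma> x - secant \<gamma> y = (d - (y - x) * secant \<gamma> y) / (1 - x)"
  proof -
    have "(secant \<gamma> x - secant \<gamma> y) * (1 - x) = (1 - x powr \<gamma>) - secant \<gamma> y * (1 - y) - secant \<gamma> y * (y - x)"
      using secant_mult[of \<gamma> x] by (simp add: algebra_simps)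
    also have "\<dots> = d - (y - x) * secant \<gamma> y"
      unfolding secant_mult d_def by (simp add: algebra_simps)
    finally show ?thesis using x1 by (simp add: eq_divide_eq)
  qed
  have ylow: "secant \<gamma> y \<le> \<gamma> * y powr (\<gamma> - 1)"
  proof (cases "y = 1")
    case False
    then show ?thesis
      using powr_le_tangent[of y 1 \<gamma>] assms by (simp add: secant_def divide_le_eq)
  qed (simp add: secant_def)
  have "(y - x) * secant \<gamma> y \<le> d"
  proof -
    have "(y - x) * secant \<gamma> y \<le> (y - x) * (\<gamma> * y powr (\<gamma> - 1))"
      using ylow xy by (intro mult_left_mono) auto
    also have "\<dots> \<le> d"
      using powr_le_tangent[of y x \<gamma>] assms by (simp add: d_def algebra_simps)
    finally show ?thesis .
  qed
  then have nonneg: "0 \<le> secant \<gamma> x - secant \<gamma> y" using eq x1 by simp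
  have "secant \<gamma> x - secant \<gamma> y \<le> 2 * d + 2 * (y - x)"
  proof (cases "x \<le> 1/2")
    case True
    have "0 \<le> (y - x) * secant \<gamma> y" using secant_ge[of \<gamma> y] assms by simp
    then have "(d - (y - x) * secant \<gamma> y) / (1 - x) \<le> d / (1 - x)"
      using x1 by (intro divide_right_mono) auto
    also have "\<dots> \<le> d / (1/2)"
      using True d0 by (intro divide_left_mono) auto
    finally show ?thesis using eq xy by simp
  next
    case False
    have "d \<le> \<gamma> * x powr (\<gamma> - 1) * (y - x)"
      using powr_le_tangent[of x y \<gamma>] assms False by (simp add: d_def)
    moreover have "(y - x) * \<gamma> \<le> (y - x) * secant \<gamma> y"
      using secant_ge[of \<gamma> y] assms by (intro mult_left_mono) auto
    \<comment> \<open>The tangent slope at \<open>x\<close> and the lower bound \<gamma> for the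
      chord slope differ by a term of order 1 - x, which compensates the denominator.\<close>
    ultimately have "d - (y - x) * secant \<gamma> y \<le> (y - x) * (\<gamma> * (x powr (\<gamma> - 1) - 1))"
      by (simp add: algebra_simps)
    also have "\<dots> \<le> (y - x) * (1 * (2 * (1 - x)))"
    proof (intro mult_left_mono mult_mono)
      have "x powr (\<gamma> - 1) \<le> x powr (-1)" using False x1 \<gamma> by (intro powr_mono') auto
      also have "\<dots> = 1 / x" using False powr_minus_divide[of x 1] by simp
      finally have "x powr (\<gamma> - 1) - 1 \<le> (1 - x) / x" using False by (simp add: field_simps)
      also have "\<dots> \<le> (1 - x) / (1/2)" using False x1 by (intro divide_left_mono) auto
      finally show "x powr (\<gamma> - 1) - 1 \<le> 2 * (1 - x)" by simp
      show "0 \<le> x powr (\<gamma> - 1) - 1"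
        using False x1 \<gamma> powr_mono'[of "\<gamma> - 1" 0 x] by simp
    qed (use \<gamma> xy in auto)
    finally have "(d - (y - x) * secant \<gamma> y) / (1 - x) \<le> (y - x) * 2"
      using x1 by (simp only: divide_le_eq mult.assoc mult_1) simp
    then show ?thesis using eq d0 by simp
  qed
  then show ?thesis using nonneg by (simp add: d_def)
qed

lemma abs_secant_diff_le:
  fixes x y \<gamma> :: real
  assumes \<gamma>: "0 < \<gamma>" "\<gamma> < 1" and xy: "x \<in> {0..1}" "y \<in> {0..1}"
  shows "\<bar>secant \<gamma> x - secant \<gamma> y\<bar> \<le> 2 * \<bar>x powr \<gamma> - y powr \<gamma>\<bar> + 2 * \<bar>x - y\<bar>"
proof (cases x y rule: linorder_cases)
  case less
  then have "\<bar>secant \<gamma> x - secant \<gamma> y\<bar> \<le> 2 * (y powr \<gamma> - x powr \<gamma>) + 2 * (y - x)"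
    using secant_diff_le[of \<gamma> x y] assms by auto
  also have "\<dots> \<le> 2 * \<bar>y powr \<gamma> - x powr \<gamma>\<bar> + 2 * \<bar>y - x\<bar>"
    by (intro add_mono mult_left_mono abs_ge_self) auto
  finally show ?thesis by (simp only: abs_minus_commute)
next
  case greater
  then have "\<bar>secant \<gamma> y - secant \<gamma> x\<bar> \<le> 2 * (x powr \<gamma> - y powr \<gamma>) + 2 * (x - y)"
    using secant_diff_le[of \<gamma> y x] assms by auto
  also have "\<dots> \<le> 2 * \<bar>x powr \<gamma> - y powr \<gamma>\<bar> + 2 * \<bar>x - y\<bar>"
    by (intro add_mono mult_left_mono abs_ge_self) auto
  finally show ?thesis by (simp only: abs_minus_commute)
qed simp

lemma continuous_on_secant:
  assumes \<gamma>: "0 < \<gamma>" "\<gamma> < 1"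
  shows "continuous_on {0..1} (secant \<gamma>)"
  unfolding continuous_on_def
proof
  fix x :: real assume x: "x \<in> {0..1}"
  have "((\<lambda>y. secant \<gamma> y - secant \<gamma> x) \<longlongrightarrow> 0) (at x within {0..1})"
  proof (rule Lim_null_comparison)
    show "\<forall>\<^sub>F y in at x within {0..1}.
        norm (secant \<gamma> y - secant \<gamma> x) \<le> 2 * \<bar>y powr \<gamma> - x powr \<gamma>\<bar> + 2 * \<bar>y - x\<bar>"
      using abs_secant_diff_le[OF \<gamma> _ x] by (auto simp: eventually_at_topological)
    have "continuous_on {0..1} (\<lambda>y::real. 2 * \<bar>y powr \<gamma> - x powr \<gamma>\<bar> + 2 * \<bar>y - x\<bar>)"
      using \<gamma> by (intro continuous_intros continuous_on_powr') auto
    with x show "((\<lambda>y. 2 * \<bar>y powr \<gamma> - x powr \<gamma>\<bar> + 2 * \<bar>y - x\<bar>) \<longlongrightarrow> 0) (at x within {0..1})"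
      unfolding continuous_on_def by fastforce
  qed
  then show "(secant \<gamma> \<longlongrightarrow> secant \<gamma> x) (at x within {0..1})"
    by (simp add: Lim_null[symmetric])
qed

section \<open>Autonomous equations by separation of variables\<close>

lemma antiderivative_on_line:
  fixes k :: "real \<Rightarrow> real"
  assumes "continuous_on UNIV k"
  obtains F where "F 0 = 0" "\<And>x. (F has_real_derivative k x) (at x)"
    "\<And>x. 0 \<le> x \<Longrightarrow> F x = integral {0..x} k"
proof -
  \<comment> \<open>The oriented integral from 0: for x \<noteq> 0 one of the two intervals is empty
    and contributes 0.\<close>
  define F where "F x = integral {0..x} k - integral {x..0} k" for x
  have int: "k integrable_on {a..b}" for a b
    using assms by (intro integrable_continuous_real) (auto intro: continuous_on_subset)
  have "(F has_real_derivative k x) (at x)" for x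
  proof -
    define a where "a = min 0 x - 1"
    define b where "b = max 0 x + 1"
    have ab: "x \<in> {a<..<b}" "a < 0" "0 < b" by (auto simp: a_def b_def)
    have eq: "F t = integral {a..t} k - integral {a..0} k" if "t \<in> {a..b}" for t
    proof (cases "0 \<le> t")
      case True
      then show ?thesis
        using Henstock_Kurzweil_Integration.integral_combine[of a 0 t k] ab int by (cases "t = 0") (auto simp: F_def)
    next
      case False
      then show ?thesis
        using Henstock_Kurzweil_Integration.integral_combine[of a t 0 k] that int by (auto simp: F_def)
    qed
    have "((\<lambda>t. integral {a..t} k) has_real_derivative k x) (at x within {a..b})"
      using ab assms by (intro integral_has_real_derivative) (auto intro: continuous_on_subset)
    then have "((\<lambda>t. integral {a..t} k) has_real_derivative k x) (at x)"
      using ab at_within_interior[of x "{a..b}"] by simp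
    then have "((\<lambda>t. integral {a..t} k - integral {a..0} k) has_real_derivative k x) (at x)"
      by (auto intro!: derivative_eq_intros)
    then show ?thesis
      by (rule has_field_derivative_transform_within_open[of _ _ _ "{a<..<b}"])
        (use ab eq in auto)
  qed
  moreover have "F 0 = 0" by (simp add: F_def)
  moreover have "F x = integral {0..x} k" if "0 \<le> x" for x
    using that by (cases "x = 0") (auto simp: F_def)
  ultimately show ?thesis using that by blast
qed

text \<open>The solution \<theta> is the inverse of the elapsed time F, the integral of 1 / w, so
  continuity of \<open>w\<close> suffices. Evenness of \<open>w\<close> makes \<open>F\<close> odd,
  and its period makes F (x + pi) - F x the constant \<open>T\<close>; both properties pass to the
  inverse.\<close>

lemma inverse_clock:
  fixes w :: "real \<Rightarrow> real"
  assumes cont: "continuous_on UNIV w" and pos: "\<And>t. 0 < w t"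
    and even: "\<And>t. w (- t) = w t" and per: "\<And>t. w (t + pi) = w t"
    and T: "integral {0..pi} (\<lambda>t. 1 / w t) = T"
  obtains \<theta> :: "real \<Rightarrow> real" where "\<theta> 0 = 0" "\<And>y. \<theta> (- y) = - \<theta> y"
    "\<And>y. \<theta> (y + T) = \<theta> y + pi" "\<And>y. (\<theta> has_real_derivative w (\<theta> y)) (at y)"
    "strict_mono \<theta>"
proof -
  have "continuous_on UNIV (\<lambda>t. 1 / w t)"
    using cont pos by (intro continuous_intros) (auto simp: less_imp_neq[symmetric])
  then obtain F where F0: "F 0 = 0" and DF: "\<And>x. (F has_real_derivative 1 / w x) (at x)"
    and Fint: "\<And>x. 0 \<le> x \<Longrightarrow> F x = integral {0..x} (\<lambda>t. 1 / w t)"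
    by (rule antiderivative_on_line) blast
  have FT: "F pi = T" using Fint[of pi] T by simp
  have odd: "F (- x) = - F x" for x
  proof -
    have "((\<lambda>x. F x + F (- x)) has_real_derivative 0) (at x)" for x
      using DF DERIV_mirror[of F "1 / w (-x)" x] DF[of "-x"]
      by (auto intro!: derivative_eq_intros simp: even)
    then have "F x + F (- x) = F 0 + F (- 0)"
      using DERIV_isconst_all by blast
    then show ?thesis using F0 by simp
  qed
  have shift: "F (x + pi) = F x + T" for x
  proof -
    have "((\<lambda>x. F (x + pi) - F x) has_real_derivative 0) (at x)" for x
      using DF DERIV_shift[of F "1 / w (x + pi)" x pi] DF[of "x + pi"]
      by (auto intro!: derivative_eq_intros simp: per)
    then have "F (x + pi) - F x = F (0 + pi) - F 0"
      using DERIV_isconst_all by blast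
    then show ?thesis using F0 FT by simp
  qed
  have mono: "F x < F y" if "x < y" for x y
    using that pos by (intro DERIV_pos_imp_increasing[of x y F]) (auto intro!: exI DF)
  have Tpos: "T > 0" using mono[of 0 pi] F0 FT by simp
  \<comment> \<open>Since T > 0 these values are unbounded, and the intermediate value theorem then
    gives surjectivity.\<close>
  have Fn: "F (of_nat n * pi) = of_nat n * T" for n
  proof (induction n)
    case (Suc n)
    have "F (of_nat (Suc n) * pi) = F (of_nat n * pi + pi)" by (simp add: algebra_simps)
    also have "\<dots> = of_nat n * T + T" by (simp only: shift Suc)
    finally show ?case by (simp add: algebra_simps)
  qed (simp add: F0)
  have cF: "isCont F x" for x using DF DERIV_isCont by blast
  have surj: "\<exists>x. F x = y" for y
  proof -
    obtain n :: nat where n: "\<bar>y\<bar> / T < of_nat n" using reals_Archimedean2 by blast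
    then have "\<bar>y\<bar> \<le> of_nat n * T" using Tpos by (simp add: field_simps)
    then have "F (- (of_nat n * pi)) \<le> y" "y \<le> F (of_nat n * pi)"
      by (auto simp: odd Fn)
    moreover have "- (of_nat n * pi) \<le> of_nat n * pi"
      using mult_nonneg_nonneg[OF of_nat_0_le_iff pi_ge_zero, of n] by linarith
    ultimately show ?thesis
      using IVT[of F "- (of_nat n * pi)" y "of_nat n * pi"] cF by blast
  qed
  have "strict_mono F" using mono by (simp add: strict_mono_def)
  then have inj: "inj F" by (rule strict_mono_imp_inj_on)
  define \<theta> where "\<theta> = inv F"
  have F\<theta>: "F (\<theta> y) = y" for y unfolding \<theta>_def using surj[of y] by (intro f_inv_into_f) blast
  have \<theta>F: "\<theta> (F x) = x" for x using inj by (simp add: \<theta>_def)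
  have c\<theta>: "isCont \<theta> y" for y
    using isCont_inverse_function[of 1 "\<theta> y" \<theta> F] \<theta>F cF F\<theta> by auto
  show ?thesis
  proof
    show "\<theta> 0 = 0" using \<theta>F[of 0] F0 by simp
    show "\<theta> (- y) = - \<theta> y" for y using \<theta>F[of "- \<theta> y"] F\<theta> odd by simp
    show "\<theta> (y + T) = \<theta> y + pi" for y using \<theta>F[of "\<theta> y + pi"] F\<theta> shift by simp
    show "(\<theta> has_real_derivative w (\<theta> y)) (at y)" for y
      using DERIV_inverse_function[OF DF, of \<theta> y "y - 1" "y + 1"] pos[of "\<theta> y"] F\<theta> c\<theta> by simp
    show "strict_mono \<theta>"
    proof (rule strict_monoI)
      fix x y :: real assume "x < y"
      then show "\<theta> x < \<theta> y"
        using mono[of "\<theta> y" "\<theta> x"] F\<theta>[of x] F\<theta>[of y] by (cases "\<theta> x" "\<theta> y" rule: linorder_cases) auto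
    qed
  qed
qed

section \<open>Angular profiles\<close>

text \<open>The common interface of both cases. The second-order equation is demanded only off the
  zeros of \<open>h\<close>, because for \<beta> < 1 its right-hand side blows up there. The shift
  by pi/2 is a quarter turn of the plane, which puts the zeros exactly on the two axes.\<close>

locale profile =
  fixes \<mu> \<beta> b :: real and h h1 :: "real \<Rightarrow> real"
  assumes \<mu>_pos: "0 < \<mu>" and \<beta>_pos: "0 < \<beta>" and b_pos: "0 < b"
    and h_odd: "h (- y) = - h y" and h_shift: "h (y + pi/2) = - h y"
    and h1_even: "h1 (- y) = h1 y" and h1_shift: "h1 (y + pi/2) = - h1 y"
    and h_pos: "0 < y \<Longrightarrow> y < pi/2 \<Longrightarrow> 0 < h y" and h_le_1: "\<bar>h y\<bar> \<le> 1"
    and DERIV_h: "(h has_real_derivative h1 y) (at y)"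
    and energy: "(h1 y)\<^sup>2 = \<mu>\<^sup>2 * (1 - (h y)\<^sup>2) + b * (1 - \<bar>h y\<bar> powr \<beta>)"
    and DERIV_h1: "h y \<noteq> 0 \<Longrightarrow>
      (h1 has_real_derivative - \<mu>\<^sup>2 * h y - b * \<beta> / 2 * \<bar>h y\<bar> powr (\<beta> - 2) * h y) (at y)"
    and h1_cont: "continuous_on UNIV h1"
    and h1_hoelder: "\<beta> \<le> 1 \<Longrightarrow> \<exists>C. \<forall>y z. \<bar>h1 y - h1 z\<bar> \<le> C * \<bar>y - z\<bar> powr \<beta>"

text \<open>Boundedness is part of the notion so that the class is closed under products.\<close>

definition bounded_hoelder :: "real \<Rightarrow> (real \<Rightarrow> real) \<Rightarrow> bool"
  where "bounded_hoelder \<beta> f \<longleftrightarrow>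
    (\<exists>M. \<forall>x. \<bar>f x\<bar> \<le> M) \<and> (\<exists>C. \<forall>x y. \<bar>f x - f y\<bar> \<le> C * \<bar>x - y\<bar> powr \<beta>)"

text \<open>Beyond distance 1 the bound 2 M already dominates the difference, since there the power
  of the distance is at least 1.\<close>

lemma bounded_hoelderI:
  assumes \<beta>: "0 < \<beta>" and M: "\<And>x. \<bar>f x\<bar> \<le> M"
    and C: "\<And>x y. \<bar>x - y\<bar> \<le> 1 \<Longrightarrow> \<bar>f x - f y\<bar> \<le> C * \<bar>x - y\<bar> powr \<beta>"
  shows "bounded_hoelder \<beta> f"
  unfolding bounded_hoelder_def
proof (intro conjI exI allI)
  fix x y
  show "\<bar>f x\<bar> \<le> M" by (rule M)
  show "\<bar>f x - f y\<bar> \<le> (\<bar>C\<bar> + 2 * M) * \<bar>x - y\<bar> powr \<beta>"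
  proof (cases "\<bar>x - y\<bar> \<le> 1")
    case True
    have "0 \<le> M" using M[of x] by linarith
    then have "C * \<bar>x - y\<bar> powr \<beta> \<le> (\<bar>C\<bar> + 2 * M) * \<bar>x - y\<bar> powr \<beta>"
      by (intro mult_right_mono) auto
    with C[OF True] show ?thesis by linarith
  next
    case False
    have "\<bar>f x - f y\<bar> \<le> 2 * M" using M[of x] M[of y] by linarith
    also have "\<dots> \<le> \<bar>C\<bar> + 2 * M" by simp
    also have "\<dots> \<le> (\<bar>C\<bar> + 2 * M) * \<bar>x - y\<bar> powr \<beta>"
    proof (rule mult_le_cancel_left1[THEN iffD2], intro conjI impI)
      show "1 \<le> \<bar>x - y\<bar> powr \<beta>"
        using False \<beta> ge_one_powr_ge_zero[of "\<bar>x - y\<bar>" \<beta>] by simp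
      assume "\<bar>C\<bar> + 2 * M < 0"
      moreover have "0 \<le> M" using M[of x] by linarith
      ultimately show "\<bar>x - y\<bar> powr \<beta> \<le> 1" by simp
    qed
    finally show ?thesis .
  qed
qed

lemma bounded_hoelder_bounded: "bounded_hoelder \<beta> f \<Longrightarrow> \<exists>M\<ge>0. \<forall>x. \<bar>f x\<bar> \<le> M"
  unfolding bounded_hoelder_def by (meson abs_ge_zero order_trans)

lemma bounded_hoelder_lipschitz:
  assumes \<beta>: "0 < \<beta>" "\<beta> \<le> 1" and M: "\<And>x. \<bar>f x\<bar> \<le> M" and L: "0 \<le> L"
    and C: "\<And>x y. \<bar>f x - f y\<bar> \<le> L * \<bar>x - y\<bar>"
  shows "bounded_hoelder \<beta> f"
proof (rule bounded_hoelderI[OF \<beta>(1) M])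
  fix x y :: real assume 1: "\<bar>x - y\<bar> \<le> 1"
  have "\<bar>x - y\<bar> \<le> \<bar>x - y\<bar> powr \<beta>"
    using powr_mono'[of \<beta> 1 "\<bar>x - y\<bar>"] 1 \<beta> by (cases "x = y") auto
  then show "\<bar>f x - f y\<bar> \<le> L * \<bar>x - y\<bar> powr \<beta>"
    using C[of x y] L mult_left_mono by (meson order_trans)
qed

lemma bounded_hoelder_add:
  assumes "bounded_hoelder \<beta> f" "bounded_hoelder \<beta> g"
  shows "bounded_hoelder \<beta> (\<lambda>x. f x + g x)"
proof -
  from assms obtain M N C D where
    *: "\<And>x. \<bar>f x\<bar> \<le> M" "\<And>x. \<bar>g x\<bar> \<le> N"
       "\<And>x y. \<bar>f x - f y\<bar> \<le> C * \<bar>x - y\<bar> powr \<beta>" "\<And>x y. \<bar>g x - g y\<bar> \<le> D * \<bar>x - y\<bar> powr \<beta>"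
    unfolding bounded_hoelder_def by blast
  show ?thesis unfolding bounded_hoelder_def
  proof (intro conjI exI allI)
    fix x y
    show "\<bar>f x + g x\<bar> \<le> M + N" using *(1,2)[of x] by linarith
    show "\<bar>f x + g x - (f y + g y)\<bar> \<le> (C + D) * \<bar>x - y\<bar> powr \<beta>"
      using *(3,4)[of x y] by (simp add: distrib_right)
  qed
qed

lemma bounded_hoelder_mult:
  assumes "bounded_hoelder \<beta> f" "bounded_hoelder \<beta> g"
  shows "bounded_hoelder \<beta> (\<lambda>x. f x * g x)"
proof -
  from assms obtain C D where
    *: "\<And>x y. \<bar>f x - f y\<bar> \<le> C * \<bar>x - y\<bar> powr \<beta>" "\<And>x y. \<bar>g x - g y\<bar> \<le> D * \<bar>x - y\<bar> powr \<beta>"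
    unfolding bounded_hoelder_def by blast
  obtain M N where M: "0 \<le> M" "\<And>x. \<bar>f x\<bar> \<le> M" and N: "0 \<le> N" "\<And>x. \<bar>g x\<bar> \<le> N"
    using assms bounded_hoelder_bounded by metis
  show ?thesis unfolding bounded_hoelder_def
  proof (intro conjI exI allI)
    fix x y
    show "\<bar>f x * g x\<bar> \<le> M * N" using M N by (simp add: abs_mult mult_mono)
    have "\<bar>f x * g x - f y * g y\<bar> = \<bar>f x * (g x - g y) + g y * (f x - f y)\<bar>"
      by (simp add: algebra_simps)
    also have "\<dots> \<le> \<bar>f x\<bar> * \<bar>g x - g y\<bar> + \<bar>g y\<bar> * \<bar>f x - f y\<bar>"
      by (rule order_trans[OF abs_triangle_ineq]) (simp add: abs_mult)
    also have "\<dots> \<le> M * (D * \<bar>x - y\<bar> powr \<beta>) + N * (C * \<bar>x - y\<bar> powr \<beta>)"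
      using M N * by (intro add_mono mult_mono) auto
    finally show "\<bar>f x * g x - f y * g y\<bar> \<le> (M * D + N * C) * \<bar>x - y\<bar> powr \<beta>"
      by (simp add: algebra_simps)
  qed
qed

section \<open>Lipschitz bounds and differentiation rules on the line\<close>

lemma sin_lipschitz: "\<bar>sin s - sin t\<bar> \<le> \<bar>s - t\<bar>" for s t :: real
proof -
  have "\<bar>sin s - sin t\<bar> = 2 * \<bar>sin ((s - t) / 2)\<bar> * \<bar>cos ((s + t) / 2)\<bar>"
    by (simp add: sin_diff_sin abs_mult)
  also have "\<dots> \<le> 2 * \<bar>(s - t) / 2\<bar> * 1"
    by (intro mult_mono abs_sin_x_le_abs_x) auto
  finally show ?thesis by simp
qed

lemma cos_lipschitz: "\<bar>cos s - cos t\<bar> \<le> \<bar>s - t\<bar>" for s t :: real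
  using sin_lipschitz[of "pi / 2 - s" "pi / 2 - t"] by (simp add: sin_diff abs_minus_commute)

text \<open>By L'Hopital's rule, a formula for the derivative near \<open>x\<close> that is
  continuous at \<open>x\<close> also holds at \<open>x\<close>. It serves the turning points h' =
  0, where the differentiated energy equation cannot be divided by h'.\<close>

lemma DERIV_from_punctured:
  fixes f g :: "real \<Rightarrow> real"
  assumes f: "isCont f x" and g: "isCont g x"
    and D: "\<forall>\<^sub>F y in at x. (f has_real_derivative g y) (at y)"
  shows "(f has_real_derivative g x) (at x)"
  unfolding has_field_derivative_iff
proof (rule lhopital)
  show "((\<lambda>y. f y - f x) \<longlongrightarrow> 0) (at x)" using f by (simp add: isCont_def Lim_null[symmetric])
  show "((\<lambda>y. y - x) \<longlongrightarrow> 0) (at x)" using tendsto_ident_at[of x UNIV] by (simp add: Lim_null[symmetric])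
  show "\<forall>\<^sub>F y in at x. y - x \<noteq> 0" by (auto simp: eventually_at_filter)
  show "\<forall>\<^sub>F y in at x. (1::real) \<noteq> 0" by simp
  show "\<forall>\<^sub>F y in at x. ((\<lambda>y. f y - f x) has_real_derivative g y) (at y)"
    using D by eventually_elim (auto intro!: derivative_eq_intros)
  show "\<forall>\<^sub>F y in at x. ((\<lambda>y. y - x) has_real_derivative 1) (at y)"
    by (intro always_eventually allI) (auto intro!: derivative_eq_intros)
  show "((\<lambda>y. g y / 1) \<longlongrightarrow> g x) (at x)" using g by (simp add: isCont_def)
qed

lemma DERIV_nonzero_imp_eventually_neq:
  fixes f :: "real \<Rightarrow> real"
  assumes "(f has_real_derivative D) (at x)" "D \<noteq> 0"
  shows "\<forall>\<^sub>F y in at x. f y \<noteq> f x"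
proof -
  have "\<forall>\<^sub>F y in at x. (f y - f x) / (y - x) \<noteq> 0"
    using assms unfolding has_field_derivative_iff by (intro tendsto_imp_eventually_ne)
  then show ?thesis by eventually_elim auto
qed

lemma DERIV_abs_powr:
  fixes x s :: real
  assumes "x \<noteq> 0"
  shows "((\<lambda>x. \<bar>x\<bar> powr s) has_real_derivative s * \<bar>x\<bar> powr (s - 2) * x) (at x)"
proof -
  have "(*) (s * (\<bar>x\<bar> powr (s - 2) * x)) = (\<lambda>v. s * (\<bar>x\<bar> powr (s - 2) * (x * v)))"
    by (auto simp: mult.assoc)
  then show ?thesis
    using has_derivative_norm_powr[OF assms, of s]
    by (simp add: has_field_derivative_def mult.assoc)
qed

lemma power2_powr_half: "(x\<^sup>2) powr (a / 2) = \<bar>x\<bar> powr a" for x a :: real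
proof (cases "x = 0")
  case False
  have "x\<^sup>2 = \<bar>x\<bar> powr 2" using False by (subst powr_numeral) auto
  then show ?thesis by (simp only: powr_powr) simp
qed simp

text \<open>Substituting \<open>h = sin \<theta>\<close> turns the energy equation, which degenerates at the turning
  point \<open>h = 1\<close>, into the regular autonomous equation \<open>\<theta>' = w \<theta>\<close>.\<close>

definition speed :: "real \<Rightarrow> real \<Rightarrow> real \<Rightarrow> real \<Rightarrow> real"
  where "speed \<mu> \<beta> b t = sqrt (\<mu>\<^sup>2 + b * secant (\<beta> / 2) ((sin t)\<^sup>2))"

context
  fixes \<mu> \<beta> b :: real
  assumes \<mu>: "0 < \<mu>" and \<beta>: "0 < \<beta>" "\<beta> < 2" and b: "0 \<le> b"
begin

lemma sin_sq_mem: "(sin t)\<^sup>2 \<in> {0..(1::real)}"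
  using abs_sin_le_one[of t] abs_square_le_1[of "sin t"] by simp

lemma secant_sin_ge: "\<beta> / 2 \<le> secant (\<beta> / 2) ((sin t)\<^sup>2)"
  using secant_ge[of "\<beta> / 2"] \<beta> sin_sq_mem[of t] by simp

lemma speed_arg_ge: "\<mu>\<^sup>2 \<le> \<mu>\<^sup>2 + b * secant (\<beta> / 2) ((sin t)\<^sup>2)"
proof -
  have "0 \<le> secant (\<beta> / 2) ((sin t)\<^sup>2)" using secant_sin_ge[of t] \<beta> by simp
  then show ?thesis using b by simp
qed

lemma speed_ge: "\<mu> \<le> speed \<mu> \<beta> b t"
  unfolding speed_def using speed_arg_ge[of t] \<mu> by (intro real_le_rsqrt)

lemma speed_pos: "0 < speed \<mu> \<beta> b t"
  using speed_ge[of t] \<mu> by simp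

lemma speed_sq: "(speed \<mu> \<beta> b t)\<^sup>2 = \<mu>\<^sup>2 + b * secant (\<beta> / 2) ((sin t)\<^sup>2)"
  using speed_arg_ge[of t] zero_le_power2[of \<mu>] unfolding speed_def by simp

lemma continuous_on_secant_sin: "continuous_on S (\<lambda>t. secant (\<beta> / 2) ((sin t)\<^sup>2))"
proof -
  have "continuous_on UNIV (secant (\<beta> / 2) \<circ> (\<lambda>t. (sin t)\<^sup>2))"
  proof (rule continuous_on_compose)
    show "continuous_on (range (\<lambda>t. (sin t)\<^sup>2)) (secant (\<beta> / 2))"
      by (rule continuous_on_subset[OF continuous_on_secant]) (use \<beta> sin_sq_mem in auto)
  qed (intro continuous_intros)
  then show ?thesis using continuous_on_subset by (fastforce simp: comp_def)
qed

lemma continuous_on_speed: "continuous_on S (speed \<mu> \<beta> b)"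
  unfolding speed_def by (intro continuous_intros continuous_on_secant_sin)

text \<open>Multiplication by cos^2 = 1 - sin^2 undoes the division inside \<open>secant\<close>.
  This is the energy equation for h = sin \<theta> and h' = cos \<theta> * \<theta>'.\<close>

lemma sin_energy:
  "(cos t * speed \<mu> \<beta> b t)\<^sup>2 = \<mu>\<^sup>2 * (1 - (sin t)\<^sup>2) + b * (1 - \<bar>sin t\<bar> powr \<beta>)"
proof -
  have "secant (\<beta> / 2) ((sin t)\<^sup>2) * (cos t)\<^sup>2 = 1 - \<bar>sin t\<bar> powr \<beta>"
    using secant_mult[of "\<beta>/2" "(sin t)\<^sup>2"] by (simp add: cos_squared_eq power2_powr_half)
  then have "(cos t)\<^sup>2 * (\<mu>\<^sup>2 + b * secant (\<beta> / 2) ((sin t)\<^sup>2)) =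
     \<mu>\<^sup>2 * (cos t)\<^sup>2 + b * (1 - \<bar>sin t\<bar> powr \<beta>)"
    by (simp only: distrib_left mult.left_commute[of _ b] mult.commute[of "(cos t)\<^sup>2"] mult.assoc)
  then show ?thesis by (simp add: power_mult_distrib speed_sq cos_squared_eq)
qed

text \<open>The squared speed inherits the modulus of \<open>secant\<close>, in which
  (sin^2)^(\<beta>/2) = |sin|^\<beta> is \<beta>-Hoelder. As the speed is at least \<mu> > 0, taking
  the square root only costs the factor 1 / (2 \<mu>).\<close>

lemma speed_hoelder:
  assumes "\<beta> \<le> 1"
  obtains C where "0 \<le> C" "\<And>s t. \<bar>speed \<mu> \<beta> b s - speed \<mu> \<beta> b t\<bar> \<le> C * (\<bar>s - t\<bar> powr \<beta> + \<bar>s - t\<bar>)"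
proof
  show "0 \<le> b / (2 * \<mu>) * 4" using \<mu> b by simp
  fix s t :: real
  let ?w = "speed \<mu> \<beta> b" and ?q = "\<lambda>t. secant (\<beta> / 2) ((sin t)\<^sup>2)"
  have sin: "\<bar>\<bar>sin s\<bar> - \<bar>sin t\<bar>\<bar> \<le> \<bar>s - t\<bar>"
  proof -
    show ?thesis using sin_lipschitz[of s t] by linarith
  qed
  have "\<bar>?q s - ?q t\<bar> \<le> 2 * \<bar>\<bar>sin s\<bar> powr \<beta> - \<bar>sin t\<bar> powr \<beta>\<bar> + 2 * \<bar>(sin s)\<^sup>2 - (sin t)\<^sup>2\<bar>"
    using abs_secant_diff_le[of "\<beta> / 2" "(sin s)\<^sup>2" "(sin t)\<^sup>2"] \<beta> sin_sq_mem by (simp only: power2_powr_half)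
  also have "\<dots> \<le> 2 * \<bar>s - t\<bar> powr \<beta> + 2 * (2 * \<bar>s - t\<bar>)"
  proof (intro add_mono mult_left_mono)
    have "\<bar>\<bar>sin s\<bar> powr \<beta> - \<bar>sin t\<bar> powr \<beta>\<bar> \<le> \<bar>\<bar>sin s\<bar> - \<bar>sin t\<bar>\<bar> powr \<beta>"
      using \<beta> assms by (intro abs_powr_diff_le) auto
    also have "\<dots> \<le> \<bar>s - t\<bar> powr \<beta>" using sin \<beta> by (intro powr_mono2) auto
    finally show "\<bar>\<bar>sin s\<bar> powr \<beta> - \<bar>sin t\<bar> powr \<beta>\<bar> \<le> \<bar>s - t\<bar> powr \<beta>" .
    have "\<bar>(sin s)\<^sup>2 - (sin t)\<^sup>2\<bar> = \<bar>(\<bar>sin s\<bar>)\<^sup>2 - (\<bar>sin t\<bar>)\<^sup>2\<bar>" by simp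
    also have "\<dots> = (\<bar>sin s\<bar> + \<bar>sin t\<bar>) * \<bar>\<bar>sin s\<bar> - \<bar>sin t\<bar>\<bar>"
      by (simp only: power2_eq_square square_diff_square_factored abs_mult) simp
    also have "\<dots> \<le> 2 * \<bar>s - t\<bar>"
      using sin add_mono[OF abs_sin_le_one[of s] abs_sin_le_one[of t]] by (intro mult_mono) auto
    finally show "\<bar>(sin s)\<^sup>2 - (sin t)\<^sup>2\<bar> \<le> 2 * \<bar>s - t\<bar>" .
  qed auto
  finally have q: "\<bar>?q s - ?q t\<bar> \<le> 4 * (\<bar>s - t\<bar> powr \<beta> + \<bar>s - t\<bar>)"
    by (rule order_trans) simp
  have "(?w s - ?w t) * (?w s + ?w t) = b * (?q s - ?q t)"
    using speed_sq[of s] speed_sq[of t] by (simp add: algebra_simps power2_eq_square)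
  then have "\<bar>?w s - ?w t\<bar> * (?w s + ?w t) = b * \<bar>?q s - ?q t\<bar>"
    using speed_pos[of s] speed_pos[of t] b
    by (metis abs_mult abs_of_nonneg abs_of_pos add_pos_pos)
  moreover have "\<bar>?w s - ?w t\<bar> * (2 * \<mu>) \<le> \<bar>?w s - ?w t\<bar> * (?w s + ?w t)"
    using speed_ge[of s] speed_ge[of t] by (intro mult_left_mono) auto
  ultimately have "\<bar>?w s - ?w t\<bar> * (2 * \<mu>) \<le> b * (4 * (\<bar>s - t\<bar> powr \<beta> + \<bar>s - t\<bar>))"
    using q b mult_left_mono[OF q b] by linarith
  then show "\<bar>?w s - ?w t\<bar> \<le> b / (2 * \<mu>) * 4 * (\<bar>s - t\<bar> powr \<beta> + \<bar>s - t\<bar>)"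
    using \<mu> by (simp add: field_simps)
qed

end

text \<open>At b = 0 the speed is the constant \<mu> < 2, which needs the time pi / \<mu> > pi / 2
  to gain pi. A large \<open>b\<close> brings the time down to at most pi / 2, and it depends
  continuously on \<open>b\<close>.\<close>

lemma speed_parameter_exists:
  fixes \<mu> \<beta> :: real
  assumes \<mu>: "0 < \<mu>" "\<mu> < 2" and \<beta>: "0 < \<beta>" "\<beta> < 2"
  obtains b where "0 < b" "integral {0..pi} (\<lambda>t. 1 / speed \<mu> \<beta> b t) = pi / 2"
proof -
  define T where "T b = integral (cbox 0 pi) (\<lambda>t. 1 / speed \<mu> \<beta> b t)" for b
  have "continuous_on {0..} T"
    unfolding T_def
  proof (rule integral_continuous_on_param)
    have "continuous_on ({0..} \<times> cbox 0 pi) (\<lambda>(b, t). secant (\<beta> / 2) ((sin t)\<^sup>2))"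
      using continuous_on_compose[OF continuous_on_snd[OF continuous_on_id]
          continuous_on_secant_sin[OF \<mu>(1) \<beta>(1,2), of 0]]
      by (simp add: comp_def case_prod_beta)
    then show "continuous_on ({0..} \<times> cbox 0 pi) (\<lambda>(b, t). 1 / speed \<mu> \<beta> b t)"
      using speed_pos[OF \<mu>(1) \<beta>]
      unfolding speed_def case_prod_beta
      by (intro continuous_intros) (auto simp: less_imp_neq[symmetric] speed_def simp del: real_sqrt_eq_zero_cancel_iff)
  qed
  moreover have "T 0 = pi / \<mu>"
    using \<mu> by (simp add: T_def speed_def)
  then have "pi / 2 < T 0"
    using \<mu> divide_strict_left_mono[of \<mu> 2 pi] by simp
  \<comment> \<open>The chord slope is at least \<beta> / 2, so b = 8 / \<beta> adds at least 4
    under the root and the speed is at least 2.\<close>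
  moreover have "T (8 / \<beta>) \<le> pi / 2"
  proof -
    have b: "0 \<le> 8 / \<beta>" using \<beta> by simp
    have "1 / speed \<mu> \<beta> (8 / \<beta>) t \<le> 1 / 2" for t
    proof -
      have "8 / \<beta> * (\<beta> / 2) \<le> 8 / \<beta> * secant (\<beta> / 2) ((sin t)\<^sup>2)"
        using secant_sin_ge[OF \<mu>(1) \<beta> b, of t] b by (intro mult_left_mono)
      then have "2\<^sup>2 \<le> \<mu>\<^sup>2 + 8 / \<beta> * secant (\<beta> / 2) ((sin t)\<^sup>2)"
        using \<beta> zero_le_power2[of \<mu>] by (simp add: add_increasing)
      then have "2 \<le> speed \<mu> \<beta> (8 / \<beta>) t"
        unfolding speed_def by (rule real_le_rsqrt)
      then show ?thesis by (intro divide_left_mono) auto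
    qed
    then have "T (8 / \<beta>) \<le> integral (cbox 0 pi) (\<lambda>t. 1 / 2)"
      unfolding T_def using speed_pos[OF \<mu>(1) \<beta> b] continuous_on_speed[OF \<mu>(1) \<beta> b]
      by (intro integral_le integrable_continuous continuous_intros)
        (auto simp: less_imp_neq[symmetric])
    then show ?thesis by simp
  qed
  ultimately obtain b where "0 \<le> b" "T b = pi / 2"
    using IVT2'[of T "8 / \<beta>" "pi / 2" 0] \<beta> continuous_on_subset[of "{0..}" T "{0..8 / \<beta>}"] by auto
  moreover have "b \<noteq> 0" using calculation \<open>pi / 2 < T 0\<close> by auto
  ultimately show ?thesis using that[of b] by (simp add: T_def cbox_interval)
qed

lemma speed_le:
  assumes \<beta>: "0 < \<beta>" "\<beta> < 2" and b: "0 \<le> b"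
  shows "speed \<mu> \<beta> b t \<le> sqrt (\<mu>\<^sup>2 + b * 5)"
proof -
  \<comment> \<open>Comparison with the point 1: there the slope is \<beta> / 2 < 1, and the modulus
    of continuity allows a deviation of at most 2 + 2.\<close>
  have "secant (\<beta> / 2) ((sin t)\<^sup>2) \<le> 5"
  proof -
    have x: "(sin t)\<^sup>2 \<in> {0..1}"
      using abs_sin_le_one[of t] abs_square_le_1[of "sin t"] by simp
    have "((sin t)\<^sup>2) powr (\<beta> / 2) \<le> 1" using x \<beta> powr_le1 by auto
    then have "\<bar>((sin t)\<^sup>2) powr (\<beta> / 2) - 1\<bar> \<le> 1" using powr_ge_zero[of "(sin t)\<^sup>2" "\<beta> / 2"] by linarith
    moreover have "\<bar>(sin t)\<^sup>2 - 1\<bar> \<le> 1" using x by auto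
    moreover have "\<bar>secant (\<beta> / 2) ((sin t)\<^sup>2) - \<beta> / 2\<bar>
        \<le> 2 * \<bar>((sin t)\<^sup>2) powr (\<beta> / 2) - 1\<bar> + 2 * \<bar>(sin t)\<^sup>2 - 1\<bar>"
      using abs_secant_diff_le[of "\<beta> / 2" "(sin t)\<^sup>2" 1] x \<beta> by (simp add: secant_def)
    ultimately have "\<bar>secant (\<beta> / 2) ((sin t)\<^sup>2) - \<beta> / 2\<bar> \<le> 2 * 1 + 2 * 1"
      by (meson add_mono mult_left_mono order_trans zero_le_numeral)
    then show ?thesis using \<beta> by (simp add: abs_le_iff)
  qed
  then show ?thesis
    unfolding speed_def using b by (intro real_sqrt_le_mono add_left_mono mult_left_mono)
qed

lemma profile_exists:
  fixes \<mu> \<beta> :: real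
  assumes \<mu>: "0 < \<mu>" "\<mu> < 2" and \<beta>: "0 < \<beta>" "\<beta> < 2"
  obtains b h h1 where "profile \<mu> \<beta> b h h1"
proof -
  obtain b where b: "0 < b" and T: "integral {0..pi} (\<lambda>t. 1 / speed \<mu> \<beta> b t) = pi / 2"
    using speed_parameter_exists[OF assms] by blast
  then have b0: "0 \<le> b" by simp
  note ctx = \<mu>(1) \<beta> b0
  obtain \<theta> where \<theta>: "\<theta> 0 = 0" "\<And>y. \<theta> (- y) = - \<theta> y" "\<And>y. \<theta> (y + pi / 2) = \<theta> y + pi"
    "\<And>y. (\<theta> has_real_derivative speed \<mu> \<beta> b (\<theta> y)) (at y)" "strict_mono \<theta>"
    by (rule inverse_clock[OF continuous_on_speed[OF ctx] speed_pos[OF ctx] _ _ T])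
      (auto simp: speed_def)
  define h where "h y = sin (\<theta> y)" for y
  define h1 where "h1 y = cos (\<theta> y) * speed \<mu> \<beta> b (\<theta> y)" for y
  \<comment> \<open>Half of the derivative, with respect to h, of the right-hand side of the energy
    equation.\<close>
  define h2 where "h2 y = - \<mu>\<^sup>2 * h y - b * \<beta> / 2 * \<bar>h y\<bar> powr (\<beta> - 2) * h y" for y
  have \<theta>_cont: "continuous_on S \<theta>" for S
    using \<theta>(4) DERIV_isCont continuous_at_imp_continuous_on by blast
  have Dh: "(h has_real_derivative h1 y) (at y)" for y
    unfolding h_def h1_def by (auto intro!: derivative_eq_intros \<theta>(4))
  have h_cont: "continuous_on S h" for S
    unfolding h_def by (intro continuous_intros \<theta>_cont)
  have "continuous_on UNIV (speed \<mu> \<beta> b \<circ> \<theta>)"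
    by (intro continuous_on_compose \<theta>_cont continuous_on_speed[OF ctx])
  then have h1_cont: "continuous_on UNIV h1"
    unfolding h1_def by (intro continuous_intros \<theta>_cont) (simp add: comp_def)
  have energy: "(h1 y)\<^sup>2 = \<mu>\<^sup>2 * (1 - (h y)\<^sup>2) + b * (1 - \<bar>h y\<bar> powr \<beta>)" for y
    unfolding h_def h1_def by (rule sin_energy[OF ctx])
  have step: "(h1 has_real_derivative h2 y) (at y)" if "h y \<noteq> 0" "h1 y \<noteq> 0" for y
  proof -
    have "(\<lambda>z. \<mu>\<^sup>2 * (1 - (h z)\<^sup>2) + b * (1 - \<bar>h z\<bar> powr \<beta>)) = (\<lambda>z. (h1 z)\<^sup>2)"
      using energy by auto
    moreover have "((\<lambda>z. \<mu>\<^sup>2 * (1 - (h z)\<^sup>2) + b * (1 - \<bar>h z\<bar> powr \<beta>)) has_real_derivative 2 * h1 y * h2 y) (at y)"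
      by (rule derivative_eq_intros Dh DERIV_chain2[where f = "\<lambda>x. \<bar>x\<bar> powr \<beta>" and g = h, OF DERIV_abs_powr[OF that(1)]] refl)+
        (simp add: h2_def algebra_simps)
    ultimately have D: "((\<lambda>z. (h1 z)\<^sup>2) has_real_derivative 2 * h1 y * h2 y) (at y)" by simp
    \<comment> \<open>So far only the square of \<open>h1\<close> is known to be differentiable.
      Near \<open>y\<close> the function \<open>h1\<close> keeps its sign and is that sign times the
      root of its square.\<close>
    have "((\<lambda>z. sgn (h1 y) * sqrt ((h1 z)\<^sup>2)) has_real_derivative
        sgn (h1 y) * (inverse (sqrt ((h1 y)\<^sup>2)) / 2 * (2 * h1 y * h2 y))) (at y)"
      using that
      by (intro DERIV_cmult DERIV_chain2[where f = sqrt and g = "\<lambda>z. (h1 z)\<^sup>2", OF DERIV_real_sqrt D]) auto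
    moreover have "sgn (h1 y) * (inverse (sqrt ((h1 y)\<^sup>2)) / 2 * (2 * h1 y * h2 y)) = h2 y"
      using that by (auto simp: sgn_if)
    ultimately have D': "((\<lambda>z. sgn (h1 y) * sqrt ((h1 z)\<^sup>2)) has_real_derivative h2 y) (at y)"
      by (simp only:)
    have "open {z. 0 < sgn (h1 y) * h1 z}"
      by (intro open_Collect_less continuous_intros h1_cont)
    moreover have "y \<in> {z. 0 < sgn (h1 y) * h1 z}" using that by (simp add: sgn_if)
    ultimately show ?thesis
      by (rule has_field_derivative_transform_within_open[OF D'])
        (auto simp: sgn_if split: if_splits)
  qed
  have Dh1: "(h1 has_real_derivative h2 y) (at y)" if "h y \<noteq> 0" for y
  proof (cases "h1 y = 0")
    case True
    show ?thesis
    proof (rule DERIV_from_punctured)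
      show "isCont h1 y" using h1_cont by (simp add: continuous_on_eq_continuous_at)
      have "isCont h y" using Dh DERIV_isCont by blast
      then show "isCont h2 y" unfolding h2_def using that by (auto intro!: continuous_intros)
      have "\<forall>\<^sub>F z in at y. h z \<noteq> 0"
        using \<open>isCont h y\<close> that unfolding isCont_def by (rule tendsto_imp_eventually_ne)
      \<comment> \<open>Turning points are isolated: where sin \<theta> is nonzero, cos \<theta> has
        nonzero derivative.\<close>
      moreover have "\<forall>\<^sub>F z in at y. cos (\<theta> z) \<noteq> cos (\<theta> y)"
      proof (rule DERIV_nonzero_imp_eventually_neq)
        show "((\<lambda>z. cos (\<theta> z)) has_real_derivative - sin (\<theta> y) * speed \<mu> \<beta> b (\<theta> y)) (at y)"
          by (auto intro!: derivative_eq_intros \<theta>(4))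
        show "- sin (\<theta> y) * speed \<mu> \<beta> b (\<theta> y) \<noteq> 0"
          using that speed_pos[OF ctx, of "\<theta> y"] by (simp add: h_def)
      qed
      ultimately have "\<forall>\<^sub>F z in at y. h z \<noteq> 0 \<and> cos (\<theta> z) \<noteq> cos (\<theta> y)"
        by (rule eventually_conj)
      moreover have "cos (\<theta> y) = 0" using True speed_pos[OF ctx, of "\<theta> y"] by (simp add: h1_def)
      ultimately show "\<forall>\<^sub>F z in at y. (h1 has_real_derivative h2 z) (at z)"
        by (auto elim!: eventually_mono intro!: step simp: h1_def less_imp_neq[OF speed_pos[OF ctx], THEN not_sym])
    qed
  qed (use step that in auto)
  \<comment> \<open>The bounded speed makes \<theta> Lipschitz, so \<open>h1\<close> is a product of
    two bounded \<beta>-Hoelder functions.\<close>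
  have hoelder: "\<exists>C. \<forall>y z. \<bar>h1 y - h1 z\<bar> \<le> C * \<bar>y - z\<bar> powr \<beta>" if \<beta>1: "\<beta> \<le> 1"
  proof -
    define W where "W = sqrt (\<mu>\<^sup>2 + b * 5)"
    have W: "speed \<mu> \<beta> b t \<le> W" for t using speed_le[OF \<beta> b0] by (simp add: W_def)
    have W0: "0 < W" using W[of 0] speed_pos[OF ctx, of 0] by linarith
    have lip: "\<bar>\<theta> y - \<theta> z\<bar> \<le> W * \<bar>y - z\<bar>" for y z
    proof -
      have "norm (\<theta> y - \<theta> z) \<le> W * norm (y - z)"
        by (rule field_differentiable_bound[of UNIV \<theta> "\<lambda>y. speed \<mu> \<beta> b (\<theta> y)"])
          (use \<theta>(4) W speed_pos[OF ctx] in \<open>auto simp: abs_of_pos\<close>)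
      then show ?thesis by simp
    qed
    have 1: "bounded_hoelder \<beta> (\<lambda>y. cos (\<theta> y))"
      by (rule bounded_hoelder_lipschitz[OF \<beta>(1) \<beta>1 _ less_imp_le[OF W0], of _ 1])
        (auto intro: order_trans[OF cos_lipschitz lip])
    obtain C where C: "0 \<le> C" "\<And>s t. \<bar>speed \<mu> \<beta> b s - speed \<mu> \<beta> b t\<bar> \<le> C * (\<bar>s - t\<bar> powr \<beta> + \<bar>s - t\<bar>)"
      using speed_hoelder[OF ctx \<beta>1] by blast
    have 2: "bounded_hoelder \<beta> (\<lambda>y. speed \<mu> \<beta> b (\<theta> y))"
    proof (rule bounded_hoelderI[OF \<beta>(1)])
      show "\<bar>speed \<mu> \<beta> b (\<theta> y)\<bar> \<le> W" for y using W speed_pos[OF ctx] by (simp add: abs_of_pos)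
      fix y z :: real assume 1: "\<bar>y - z\<bar> \<le> 1"
      have y: "\<bar>y - z\<bar> \<le> \<bar>y - z\<bar> powr \<beta>"
        using powr_mono'[of \<beta> 1 "\<bar>y - z\<bar>"] 1 \<beta> \<beta>1 by (cases "y = z") auto
      have "\<bar>speed \<mu> \<beta> b (\<theta> y) - speed \<mu> \<beta> b (\<theta> z)\<bar> \<le> C * (\<bar>\<theta> y - \<theta> z\<bar> powr \<beta> + \<bar>\<theta> y - \<theta> z\<bar>)"
        by (rule C)
      also have "\<dots> \<le> C * ((W * \<bar>y - z\<bar>) powr \<beta> + W * \<bar>y - z\<bar>)"
        using lip C \<beta> by (intro mult_left_mono add_mono powr_mono2) auto
      also have "\<dots> \<le> C * (W powr \<beta> * \<bar>y - z\<bar> powr \<beta> + W * \<bar>y - z\<bar> powr \<beta>)"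
        using y W0 C by (intro mult_left_mono add_mono) (auto simp: powr_mult)
      finally show "\<bar>speed \<mu> \<beta> b (\<theta> y) - speed \<mu> \<beta> b (\<theta> z)\<bar> \<le> C * (W powr \<beta> + W) * \<bar>y - z\<bar> powr \<beta>"
        by (simp add: algebra_simps)
    qed
    show ?thesis
      using bounded_hoelder_mult[OF 1 2] unfolding bounded_hoelder_def h1_def by blast
  qed
  have "profile \<mu> \<beta> b h h1"
  proof
    show "0 < h y" if "0 < y" "y < pi / 2" for y
    proof -
      have "\<theta> 0 < \<theta> y" "\<theta> y < \<theta> (0 + pi / 2)" using that \<theta>(5) by (auto simp: strict_mono_less)
      then show ?thesis unfolding \<theta>(3) \<theta>(1) h_def by (intro sin_gt_zero) auto
    qed
    show "(h1 has_real_derivative - \<mu>\<^sup>2 * h y - b * \<beta> / 2 * \<bar>h y\<bar> powr (\<beta> - 2) * h y) (at y)"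
      if "h y \<noteq> 0" for y using Dh1[OF that] by (simp add: h2_def)
  qed (use assms b Dh energy h1_cont hoelder \<theta>(2,3) in \<open>auto simp: h_def h1_def speed_def sin_add cos_add\<close>)
  then show ?thesis by (rule that)
qed

section \<open>Flows with homogeneous stream function\<close>

text \<open>The angle of the line through \<open>0\<close> and \<open>x\<close>, so that \<open>\<pi>\<close>-periodic functions of the polar
  angle are functions of \<open>ang\<close>.\<close>

definition ang :: "real^2 \<Rightarrow> real"
  where "ang x = (if x $ 1 = 0 then pi / 2 else arctan (x $ 2 / x $ 1))"

lemma ang_scaleR: "c \<noteq> 0 \<Longrightarrow> ang (c *\<^sub>R x) = ang x"
  by (simp add: ang_def)

lemma ang_reflect:
  assumes "x $ 1 \<noteq> 0"
  shows "ang (vector [- (x $ 1), x $ 2]) = - ang x" "ang (vector [x $ 1, - (x $ 2)]) = - ang x"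
  using assms by (simp_all add: ang_def arctan_minus)

lemma ang_off_axes:
  assumes "x \<in> off_axes"
  shows "ang x \<noteq> 0" "\<bar>ang x\<bar> < pi / 2"
  using arctan_bounded[of "x $ 2 / x $ 1"] assms[unfolded off_axes_iff] by (auto simp: ang_def)

lemma has_derivative_ang:
  assumes "x $ 1 \<noteq> 0"
  shows "(ang has_derivative (\<lambda>v. norm x powr (-2) * (x $ 1 * v $ 2 - x $ 2 * v $ 1))) (at x)"
proof -
  have n: "norm x powr (-2) = 1 / ((x $ 1)\<^sup>2 + (x $ 2)\<^sup>2)"
    using assms norm_vec2[of x] by (subst powr_minus_divide) (simp add: powr_numeral)
  have s: "(x $ 1)\<^sup>2 + (x $ 2)\<^sup>2 \<noteq> 0" using assms by (simp add: sum_power2_eq_zero_iff)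
  have "((\<lambda>x. arctan (x $ 2 / x $ 1)) has_derivative
      (\<lambda>v. norm x powr (-2) * (x $ 1 * v $ 2 - x $ 2 * v $ 1))) (at x)"
    unfolding n
    by (rule derivative_eq_intros has_derivative_nth2 refl assms)+
      (use assms s in \<open>auto simp: fun_eq_iff divide_simps power2_eq_square\<close>)
  moreover have "open {x::real^2. x $ 1 \<noteq> 0}" by (intro open_Collect_neq continuous_intros)
  ultimately show ?thesis
    by (rule has_derivative_transform_within_open[of _ _ _ _ "{x. x $ 1 \<noteq> 0}"])
      (use assms in \<open>auto simp: ang_def\<close>)
qed

section \<open>Functions of the polar angle modulo pi\<close>

lemma periodic_int:
  fixes F :: "real \<Rightarrow> 'a"
  assumes "\<And>y. F (y + pi) = F y"
  shows "F (y + of_int k * pi) = F y"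
proof -
  have *: "F (y + of_nat n * pi) = F y" for n y
  proof (induction n)
    case (Suc n)
    have "F (y + of_nat (Suc n) * pi) = F ((y + of_nat n * pi) + pi)" by (simp add: algebra_simps)
    then show ?case using assms Suc by simp
  qed simp
  show ?thesis
  proof (cases k rule: int_cases2)
    case (nonneg n)
    then show ?thesis using * by simp
  next
    case (nonpos n)
    then show ?thesis using *[of "y + of_int k * pi" n] by simp
  qed
qed

text \<open>Both angles describe the same line through the origin, so the sine of their difference
  vanishes.\<close>

lemma ang_polar:
  assumes "0 < r"
  obtains k :: int where "\<phi> = ang (polar r \<phi>) + of_int k * pi"
proof -
  have "sin (\<phi> - ang (polar r \<phi>)) = 0"
  proof (cases "cos \<phi> = 0")
    case True
    then show ?thesis using assms by (simp add: ang_def polar_def sin_diff)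
  next
    case False
    define a where "a = arctan (sin \<phi> / cos \<phi>)"
    have "tan a = sin \<phi> / cos \<phi>" by (simp add: a_def tan_arctan)
    then have "sin \<phi> * cos a = cos \<phi> * sin a"
      using False by (simp add: tan_def a_def cos_arctan_not_zero field_simps)
    then show ?thesis using assms False by (simp add: ang_def polar_def sin_diff a_def)
  qed
  then obtain k :: int where "\<phi> - ang (polar r \<phi>) = of_int k * pi"
    by (auto simp: sin_zero_iff_int2)
  then have "\<phi> = ang (polar r \<phi>) + of_int k * pi" by linarith
  then show ?thesis by (rule that)
qed

lemma periodic_ang_polar:
  fixes F :: "real \<Rightarrow> 'a"
  assumes "\<And>y. F (y + pi) = F y" "0 < r"
  shows "F (ang (polar r \<phi>)) = F \<phi>"
  using ang_polar[OF assms(2), of \<phi>] periodic_int[of F, OF assms(1)] by metis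

text \<open>Across x1 = 0 the function \<open>ang\<close> jumps by pi, which \<open>F\<close> does
  not see. Near that line the chart pi/2 - arctan (x1 / x2) differs from \<open>ang\<close> by 0 or
  pi and is continuous; the two charts cover the plane without the origin.\<close>

lemma continuous_on_periodic_ang:
  fixes F :: "real \<Rightarrow> 'a::topological_space"
  assumes cont: "continuous_on UNIV F" and per: "\<And>y. F (y + pi) = F y"
  shows "continuous_on (- {0}) (\<lambda>x. F (ang x))"
proof -
  have F: "continuous_on S g \<Longrightarrow> continuous_on S (\<lambda>x. F (g x))" for S :: "(real^2) set" and g
    using continuous_on_compose2[OF cont] by blast
  have "continuous_on {x::real^2. x $ 1 \<noteq> 0} (\<lambda>x. F (arctan (x $ 2 / x $ 1)))"
    by (intro F continuous_intros) auto
  then have 1: "continuous_on {x::real^2. x $ 1 \<noteq> 0} (\<lambda>x. F (ang x))"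
    by (simp add: ang_def cong: continuous_on_cong_simp)
  have eq: "F (pi / 2 - arctan (x $ 1 / x $ 2)) = F (ang x)" if "x $ 2 \<noteq> 0" for x :: "real^2"
  proof (cases "x $ 1 = 0")
    case False
    have "arctan (x $ 2 / x $ 1) = sgn (x $ 1 / x $ 2) * pi / 2 - arctan (x $ 1 / x $ 2)"
      using Transcendental.arctan_inverse[of "x $ 1 / x $ 2"] that False by simp
    moreover have "sgn (x $ 1 / x $ 2) = 1 \<or> sgn (x $ 1 / x $ 2) = -1"
      using that False by (auto simp: sgn_if)
    ultimately have "arctan (x $ 2 / x $ 1) = pi / 2 - arctan (x $ 1 / x $ 2) \<or>
      arctan (x $ 2 / x $ 1) + pi = pi / 2 - arctan (x $ 1 / x $ 2)" by auto
    then show ?thesis using False per by (metis ang_def)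
  qed (simp add: ang_def)
  have "continuous_on {x::real^2. x $ 2 \<noteq> 0} (\<lambda>x. F (pi / 2 - arctan (x $ 1 / x $ 2)))"
    by (intro F continuous_intros) auto
  then have 2: "continuous_on {x::real^2. x $ 2 \<noteq> 0} (\<lambda>x. F (ang x))"
    by (simp add: eq cong: continuous_on_cong_simp)
  have "continuous_on ({x. x $ 1 \<noteq> 0} \<union> {x. x $ 2 \<noteq> 0}) (\<lambda>x. F (ang x))"
    by (intro continuous_on_open_Un 1 2 open_Collect_neq continuous_intros)
  moreover have "- {0} = {x::real^2. x $ 1 \<noteq> 0} \<union> {x. x $ 2 \<noteq> 0}"
    by (auto simp: vec2_eq_iff)
  ultimately show ?thesis by simp
qed

text \<open>\<open>swirl \<kappa> f0 f1\<close> is $\nabla^\perp (r^\kappa f_0(\phi))$ for \<open>f1 = f0'\<close>.\<close>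

definition swirl :: "real \<Rightarrow> (real \<Rightarrow> real) \<Rightarrow> (real \<Rightarrow> real) \<Rightarrow> real^2 \<Rightarrow> real^2"
  where "swirl \<kappa> f0 f1 x = vector
    [norm x powr (\<kappa> - 2) * (- f1 (ang x) * x $ 1 - \<kappa> * f0 (ang x) * x $ 2),
     norm x powr (\<kappa> - 2) * (\<kappa> * f0 (ang x) * x $ 1 - f1 (ang x) * x $ 2)]"

definition radial_pressure :: "real \<Rightarrow> real \<Rightarrow> real^2 \<Rightarrow> real"
  where "radial_pressure \<kappa> P x = P * norm x powr (2 * \<kappa> - 2)"

lemma has_derivative_ang_comp:
  assumes "x $ 1 \<noteq> 0" "(f has_real_derivative f') (at (ang x))"
  shows "((\<lambda>x. f (ang x)) has_derivative (\<lambda>v. f' * (norm x powr (-2) * (x $ 1 * v $ 2 - x $ 2 * v $ 1)))) (at x)"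
  using has_derivative_compose[OF has_derivative_ang[OF assms(1)]] assms(2)
  unfolding has_field_derivative_def by blast

text \<open>All identities are pointwise, so \<open>f2\<close> is a single number, the second
  derivative at one angle. It need not exist at the zeros of the profile.\<close>

locale swirl_at =
  fixes \<kappa> :: real and f0 f1 :: "real \<Rightarrow> real" and f2 :: real and x :: "real^2"
  assumes x: "x \<in> off_axes"
    and f0: "(f0 has_real_derivative f1 (ang x)) (at (ang x))"
    and f1: "(f1 has_real_derivative f2) (at (ang x))"
begin

text \<open>With this power factored out, all first derivatives of the flow are polynomials in the
  coordinates and in \<open>g0\<close>, \<open>g1\<close>, \<open>f2\<close>. The identities below
  thereby become polynomial ones.\<close>

abbreviation "R \<equiv> norm x powr (\<kappa> - 4)"
abbreviation "g0 \<equiv> f0 (ang x)"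
abbreviation "g1 \<equiv> f1 (ang x)"

lemma x1: "x $ 1 \<noteq> 0" and x0: "x \<noteq> 0"
  using x[unfolded off_axes_iff] by auto

lemma norm_powr_plus2: "norm x powr (s + 2) = norm x powr s * ((x $ 1)\<^sup>2 + (x $ 2)\<^sup>2)"
  using x0 norm_vec2[of x] by (simp add: powr_add powr_numeral)

lemma R_eq: "norm x powr (\<kappa> - 2) = R * ((x $ 1)\<^sup>2 + (x $ 2)\<^sup>2)"
  using norm_powr_plus2[of "\<kappa> - 4"] by simp

lemma has_derivative_powr_ang:
  assumes "(f has_real_derivative f') (at (ang x))"
  shows "((\<lambda>x. norm x powr (\<kappa> - 2) * f (ang x)) has_derivative
    (\<lambda>v. R * ((\<kappa> - 2) * (x \<bullet> v) * f (ang x) + (x $ 1 * v $ 2 - x $ 2 * v $ 1) * f'))) (at x)"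
proof -
  have e: "norm x powr (\<kappa> - 2) * norm x powr (-2) = R" by (simp flip: powr_add)
  show ?thesis
    by (rule derivative_eq_intros has_derivative_norm_powr[OF x0] has_derivative_ang_comp[OF x1 assms] refl)+
      (simp add: e[symmetric] algebra_simps fun_eq_iff)
qed

definition Du :: "real^2 \<Rightarrow> real^2"
  where "Du v = (let A0 = R * ((x $ 1)\<^sup>2 + (x $ 2)\<^sup>2) * g0; A1 = R * ((x $ 1)\<^sup>2 + (x $ 2)\<^sup>2) * g1;
      A0' = R * ((\<kappa> - 2) * (x \<bullet> v) * g0 + (x $ 1 * v $ 2 - x $ 2 * v $ 1) * g1);
      A1' = R * ((\<kappa> - 2) * (x \<bullet> v) * g1 + (x $ 1 * v $ 2 - x $ 2 * v $ 1) * f2)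
    in vector [- A1' * x $ 1 - A1 * v $ 1 - \<kappa> * (A0' * x $ 2 + A0 * v $ 2),
               \<kappa> * (A0' * x $ 1 + A0 * v $ 1) - A1' * x $ 2 - A1 * v $ 2])"

lemma has_derivative_swirl: "(swirl \<kappa> f0 f1 has_derivative Du) (at x)"
proof -
  define A0 A1 where "A0 = (\<lambda>x. norm x powr (\<kappa> - 2) * f0 (ang x))"
    and "A1 = (\<lambda>x. norm x powr (\<kappa> - 2) * f1 (ang x))"
  have D: "(A0 has_derivative (\<lambda>v. R * ((\<kappa> - 2) * (x \<bullet> v) * g0 + (x $ 1 * v $ 2 - x $ 2 * v $ 1) * g1))) (at x)"
    "(A1 has_derivative (\<lambda>v. R * ((\<kappa> - 2) * (x \<bullet> v) * g1 + (x $ 1 * v $ 2 - x $ 2 * v $ 1) * f2))) (at x)"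
    unfolding A0_def A1_def by (rule has_derivative_powr_ang f0 f1)+
  have eq: "swirl \<kappa> f0 f1 = (\<lambda>x. vector
      [- A1 x * x $ 1 - \<kappa> * (A0 x * x $ 2), \<kappa> * (A0 x * x $ 1) - A1 x * x $ 2])"
    by (simp add: swirl_def A0_def A1_def fun_eq_iff algebra_simps)
  show ?thesis
    unfolding eq
    apply (rule has_derivative_eq_rhs)
     apply (rule has_derivative_vector2 derivative_eq_intros D has_derivative_nth2 refl)+
    by (simp add: Du_def Let_def fun_eq_iff A0_def A1_def R_eq vec2_eq_iff algebra_simps)
qed

lemma pd_swirl: "pd j (swirl \<kappa> f0 f1) x = Du (axis j 1)"
  by (rule pd_eqI[OF has_derivative_swirl])

lemmas pd_swirl_simps = pd_swirl Du_def Let_def inner_vec2 axis_def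

lemma divergence_swirl: "divergence (swirl \<kappa> f0 f1) x = 0"
  by (simp add: divergence_def sum_2 pd_swirl_simps power2_eq_square algebra_simps)

text \<open>The polar Laplacian of the stream function.\<close>

lemma vorticity_swirl:
  "vorticity (swirl \<kappa> f0 f1) x = norm x powr (\<kappa> - 2) * (f2 + \<kappa>\<^sup>2 * g0)"
  unfolding R_eq by (simp add: vorticity_def pd_swirl_simps power2_eq_square algebra_simps)

lemma grad_radial_pressure:
  "grad (radial_pressure \<kappa> P) x = (2 * (\<kappa> - 1) * P * (R\<^sup>2 * ((x $ 1)\<^sup>2 + (x $ 2)\<^sup>2)\<^sup>2)) *\<^sub>R x"
proof -
  have e: "norm x powr (2 * \<kappa> - 2 - 2) = R\<^sup>2 * ((x $ 1)\<^sup>2 + (x $ 2)\<^sup>2)\<^sup>2"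
  proof -
    have "norm x powr (2 * \<kappa> - 2 - 2) = (norm x powr (\<kappa> - 2))\<^sup>2"
      by (simp add: power2_eq_square flip: powr_add)
    then show ?thesis by (simp add: R_eq power_mult_distrib)
  qed
  have "(radial_pressure \<kappa> P has_derivative (\<lambda>v. P * ((2 * \<kappa> - 2) * norm x powr (2 * \<kappa> - 2 - 2) * (x \<bullet> v)))) (at x)"
    unfolding radial_pressure_def by (intro has_derivative_mult_right has_derivative_norm_powr x0)
  then show ?thesis
    unfolding e by (simp add: grad_def vec2_eq_iff pd_eqI inner_axis algebra_simps)
qed

text \<open>The angular component of the momentum equation holds for every stream function
  $r^\kappa f_0(\phi)$ because the pressure is radial; the radial component is the hypothesis.\<close>

lemma euler_swirl:
  assumes "(\<kappa> - 1) * g1\<^sup>2 - \<kappa> * g0 * f2 - \<kappa>\<^sup>2 * g0\<^sup>2 = - 2 * (\<kappa> - 1) * P"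
  shows "advect (swirl \<kappa> f0 f1) (swirl \<kappa> f0 f1) x + grad (radial_pressure \<kappa> P) x = 0"
proof -
  have "advect (swirl \<kappa> f0 f1) (swirl \<kappa> f0 f1) x =
      (((\<kappa> - 1) * g1\<^sup>2 - \<kappa> * g0 * f2 - \<kappa>\<^sup>2 * g0\<^sup>2) * (R\<^sup>2 * ((x $ 1)\<^sup>2 + (x $ 2)\<^sup>2)\<^sup>2)) *\<^sub>R x"
    unfolding advect_def sum_2 vec2_eq_iff
    by (simp add: swirl_def R_eq pd_swirl_simps) (simp add: power2_eq_square algebra_simps)
  then show ?thesis
    unfolding grad_radial_pressure assms by (simp add: vec2_eq_iff algebra_simps)
qed

end

section \<open>The divergence theorem across the axes\<close>

lemma continuous_on_slices:
  fixes f :: "real \<Rightarrow> real \<Rightarrow> real"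
  assumes "continuous_on UNIV (\<lambda>(x, y). f x y)"
  shows "continuous_on S (f x)" "continuous_on S (\<lambda>x. f x y)"
    "continuous_on S (\<lambda>x. integral {c..d} (f x))" "continuous_on S (\<lambda>y. integral {c..d} (\<lambda>x. f x y))"
proof -
  have *: "continuous_on T (\<lambda>z. f (p z) (q z))" if "continuous_on T p" "continuous_on T q"
    for T :: "'t::topological_space set" and p q
    using continuous_on_compose2[OF assms continuous_on_Pair[OF that]] by simp
  show "continuous_on S (f x)" "continuous_on S (\<lambda>x. f x y)"
    by (intro * continuous_intros)+
  show "continuous_on S (\<lambda>x. integral {c..d} (f x))"
    unfolding interval_cbox
    by (rule integral_continuous_on_param) (auto simp: case_prod_beta intro!: * continuous_intros)
  show "continuous_on S (\<lambda>y. integral {c..d} (\<lambda>x. f x y))"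
    unfolding interval_cbox
    by (rule integral_continuous_on_param) (auto simp: case_prod_beta intro!: * continuous_intros)
qed

text \<open>The singularity of \<open>V1\<close> on the axes need not be integrable: the two applications of the
  fundamental theorem only need continuity across the single exceptional point.\<close>

lemma iterated_divergence_zero:
  fixes W1 W2 V1 g :: "real \<Rightarrow> real \<Rightarrow> real"
  assumes W1: "continuous_on UNIV (\<lambda>(x, y). W1 x y)" and W2: "continuous_on UNIV (\<lambda>(x, y). W2 x y)"
    and g: "continuous_on UNIV (\<lambda>(x, y). g x y)" and R: "0 \<le> R"
    and supp1: "\<And>y. W1 R y = 0" "\<And>y. W1 (- R) y = 0"
    and supp2: "\<And>x. W2 x R = 0" "\<And>x. W2 x (- R) = 0"
    and D1: "\<And>x y. x \<noteq> 0 \<Longrightarrow> y \<noteq> 0 \<Longrightarrow> ((\<lambda>x. W1 x y) has_real_derivative V1 x y) (at x)"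
    and D2: "\<And>x y. x \<noteq> 0 \<Longrightarrow> y \<noteq> 0 \<Longrightarrow> (W2 x has_real_derivative g x y - V1 x y) (at y)"
    and V1: "continuous_on {(x, y). x \<noteq> 0 \<and> y \<noteq> 0} (\<lambda>(x, y). V1 x y)"
  shows "integral {-R..R} (\<lambda>y. integral {-R..R} (\<lambda>x. g x y)) = 0"
proof -
  define K where "K y = integral {-R..R} (\<lambda>x. W2 x y)" for y
  define M where "M y = integral {-R..R} (\<lambda>x. g x y)" for y
  have K_cont: "continuous_on S K" and M_cont: "continuous_on S M" for S
    unfolding K_def M_def using continuous_on_slices(4)[OF W2] continuous_on_slices(4)[OF g] by auto
  \<comment> \<open>\<open>K\<close> is the flux through horizontal lines and \<open>M\<close> the
    line integral of the divergence. Strips that avoid y = 0 give K' = M off that line; continuity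
    of \<open>K\<close> then carries the identity across it.\<close>
  have K_diff: "K d - K c = integral {c..d} M" if cd: "c \<le> d" "0 \<notin> {c..d}" for c d
  proof -
    define G where "G x = integral {c..d} (W1 x)" for x
    \<comment> \<open>This is the strip integral of \<open>V1\<close>, rewritten by integrating the
      second derivative rule in y. Without \<open>V1\<close> the expression is defined and
      continuous at x = 0 as well.\<close>
    define G' where "G' x = integral {c..d} (g x) - (W2 x d - W2 x c)" for x
    have DG: "(G has_real_derivative G' x) (at x)" if "x \<noteq> 0" for x
    proof -
      define U where "U = {x - \<bar>x\<bar><..<x + \<bar>x\<bar>}"
      have U: "x \<in> U" "convex U" "open U" "\<And>z. z \<in> U \<Longrightarrow> z \<noteq> 0"
        using that by (auto simp: U_def)
      have ne: "y \<noteq> 0" if "y \<in> {c..d}" for y using that cd by auto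
      have V1_cont: "continuous_on {c..d} (V1 z)" if "z \<noteq> 0" for z
      proof -
        have "continuous_on {c..d} (\<lambda>y. (z, y))" by (intro continuous_intros)
        then show ?thesis
          using continuous_on_compose2[OF V1, of "{c..d}" "\<lambda>y. (z, y)"] that ne
          by (simp add: image_subset_iff)
      qed
      have "((\<lambda>x. integral (cbox c d) (W1 x)) has_field_derivative integral (cbox c d) (V1 x)) (at x within U)"
      proof (rule leibniz_rule_field_derivative[OF _ _ _ U(1,2)])
        show "((\<lambda>x. W1 x t) has_real_derivative V1 z t) (at z within U)" if "z \<in> U" "t \<in> cbox c d" for z t
          using D1[of z t] U(4) that ne has_field_derivative_at_within by auto
        show "W1 z integrable_on cbox c d" for z
          by (intro integrable_continuous continuous_on_slices(1)[OF W1])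
        show "continuous_on (U \<times> cbox c d) (\<lambda>(x, t). V1 x t)"
          by (rule continuous_on_subset[OF V1]) (use U(4) ne in \<open>auto simp del: atLeastAtMost_iff simp: cbox_interval\<close>)
      qed
      then have "(G has_real_derivative integral {c..d} (V1 x)) (at x)"
        unfolding at_within_open[OF U(1,3)] G_def cbox_interval .
      moreover have "integral {c..d} (V1 x) = G' x"
      proof -
        have "((\<lambda>y. g x y - V1 x y) has_integral (W2 x d - W2 x c)) {c..d}"
        proof (rule fundamental_theorem_of_calculus[OF cd(1)])
          show "(W2 x has_vector_derivative g x y - V1 x y) (at y within {c..d})" if "y \<in> {c..d}" for y
            using D2[OF \<open>x \<noteq> 0\<close> ne[OF that]] has_vector_derivative_at_within
            by (auto simp: has_real_derivative_iff_has_vector_derivative)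
        qed
        moreover have "integral {c..d} (\<lambda>y. g x y - V1 x y) = integral {c..d} (g x) - integral {c..d} (V1 x)"
          by (intro integral_diff integrable_continuous_real continuous_on_slices(1)[OF g] V1_cont that)
        ultimately show ?thesis by (auto simp: G'_def dest: integral_unique)
      qed
      ultimately show ?thesis by simp
    qed
    have "(G' has_integral G R - G (- R)) {-R..R}"
    proof (rule fundamental_theorem_of_calculus_interior_strong[of "{0}"])
      show "continuous_on {-R..R} G" unfolding G_def by (rule continuous_on_slices(3)[OF W1])
    qed (use R DG in \<open>auto simp: has_real_derivative_iff_has_vector_derivative\<close>)
    moreover have "W1 R = (\<lambda>_. 0)" "W1 (- R) = (\<lambda>_. 0)" using supp1 by auto
    ultimately have "integral {-R..R} G' = 0"
      by (simp add: integral_unique G_def)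
    moreover have "integral {-R..R} G' = integral {-R..R} (\<lambda>x. integral {c..d} (g x)) - (K d - K c)"
      unfolding G'_def K_def
      by (simp add: integral_diff integrable_diff integrable_continuous_real continuous_on_slices[OF g]
          continuous_on_slices[OF W2])
    moreover have "integral {-R..R} (\<lambda>x. integral {c..d} (g x)) = integral {c..d} M"
      unfolding M_def interval_cbox
      by (rule integral_swap_continuous) (rule continuous_on_subset[OF g], simp)
    ultimately show ?thesis by simp
  qed
  have DK: "(K has_real_derivative M y) (at y)" if "y \<noteq> 0" for y
  proof -
    define c d where "c = y - \<bar>y\<bar> / 2" and "d = y + \<bar>y\<bar> / 2"
    have cd: "c < y" "y < d" "0 \<notin> {c..d}" using that by (auto simp: c_def d_def)
    have "((\<lambda>t. integral {c..t} M) has_real_derivative M y) (at y within {c..d})"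
      using cd by (intro integral_has_real_derivative M_cont) auto
    then have "((\<lambda>t. integral {c..t} M) has_real_derivative M y) (at y)"
      using cd at_within_interior[of y "{c..d}"] by simp
    then have "((\<lambda>t. integral {c..t} M + K c) has_real_derivative M y) (at y)"
      by (auto intro!: derivative_eq_intros)
    then show ?thesis
      by (rule has_field_derivative_transform_within_open[of _ _ _ "{c<..<d}"])
        (use cd in \<open>auto simp: K_diff[symmetric]\<close>)
  qed
  have "(M has_integral K R - K (- R)) {-R..R}"
    by (rule fundamental_theorem_of_calculus_interior_strong[of "{0}"])
      (use R DK K_cont in \<open>auto simp: has_real_derivative_iff_has_vector_derivative\<close>)
  then show ?thesis
    unfolding M_def[symmetric] by (simp add: integral_unique K_def supp2)
qed

section \<open>Lebesgue measure on the plane as a product measure\<close>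

lemma prod_Basis_vec2:
  fixes f :: "real^2 \<Rightarrow> 'a::comm_monoid_mult"
  shows "prod f Basis = f (axis 1 1) * f (axis 2 1)"
proof -
  have B: "(Basis :: (real^2) set) = {axis 1 1, axis 2 1}"
    unfolding Basis_vec_def using exhaust_2 by (auto; metis)
  have "axis 1 1 \<noteq> (axis 2 1 :: real^2)" by (simp add: axis_eq_axis)
  then show ?thesis unfolding B by simp
qed

text \<open>It suffices to compare the volumes of boxes. The identity carries iterated integrals
  over pairs to the type \<open>real^2\<close>.\<close>

lemma lborel_vec2:
  "(lborel :: (real^2) measure) = distr lborel borel (\<lambda>(x, y). vector [x, y])" (is "_ = distr _ _ ?f")
proof (rule lborel_eqI)
  have f: "?f \<in> borel_measurable borel"
    by (intro borel_measurable_continuous_onI) (auto simp: case_prod_beta intro!: continuous_on_vector2 continuous_intros)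
  fix l u :: "real^2" assume le: "\<And>b. b \<in> Basis \<Longrightarrow> l \<bullet> b \<le> u \<bullet> b"
  have "axis i 1 \<in> (Basis :: (real^2) set)" for i by (auto simp: Basis_vec_def)
  then have le': "l $ i \<le> u $ i" for i using le[of "axis i 1"] by (simp add: inner_axis)
  have "?f -` box l u = {l $ 1<..<u $ 1} \<times> {l $ 2<..<u $ 2}"
    by (auto simp: mem_box_cart forall_2)
  then have "emeasure (distr lborel borel ?f) (box l u) = emeasure (lborel \<Otimes>\<^sub>M lborel) ({l $ 1<..<u $ 1} \<times> {l $ 2<..<u $ 2})"
    using f by (simp add: emeasure_distr lborel_prod)
  also have "\<dots> = ennreal (u $ 1 - l $ 1) * ennreal (u $ 2 - l $ 2)"
    using le' by (subst lborel.emeasure_pair_measure_Times) auto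
  also have "\<dots> = (\<Prod>b\<in>Basis. (u - l) \<bullet> b)"
    using le' by (simp add: prod_Basis_vec2 inner_axis ennreal_mult)
  finally show "emeasure (distr lborel borel ?f) (box l u) = (\<Prod>b\<in>Basis. (u - l) \<bullet> b)" .
qed simp

text \<open>A continuous function supported in a square is Lebesgue integrable, and its integral is
  an iterated Henstock-Kurzweil integral; \<open>R\<close> and \<open>I\<close> describe the
  latter.\<close>

lemma has_bochner_integral_vec2:
  fixes g :: "real^2 \<Rightarrow> real"
  assumes g: "continuous_on UNIV g" and supp: "\<And>x i. R < \<bar>x $ i\<bar> \<Longrightarrow> g x = 0"
    and I: "integral {-R..R} (\<lambda>y. integral {-R..R} (\<lambda>x. g (vector [x, y]))) = I"
  shows "has_bochner_integral lborel g I"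
proof -
  let ?f = "\<lambda>(x, y). vector [x, y] :: real^2"
  let ?Q = "cbox (-R, -R) (R, R) :: (real \<times> real) set"
  have f: "continuous_on UNIV ?f"
    by (auto simp: case_prod_beta intro!: continuous_on_vector2 continuous_intros)
  have gf: "continuous_on S (\<lambda>z. g (?f z))" for S
    using continuous_on_compose2[OF g f] continuous_on_subset by blast
  have eq: "(\<lambda>z. indicator ?Q z *\<^sub>R g (?f z)) = (\<lambda>z. g (?f z))"
  proof
    fix z :: "real \<times> real"
    show "indicator ?Q z *\<^sub>R g (?f z) = g (?f z)"
    proof (cases "z \<in> ?Q")
      case False
      then have "R < \<bar>fst z\<bar> \<or> R < \<bar>snd z\<bar>" by (cases z) auto
      then have "g (?f z) = 0" using supp[of "?f z" 1] supp[of "?f z" 2] by (auto simp: case_prod_beta)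
      then show ?thesis by simp
    qed simp
  qed
  have "integrable lborel (\<lambda>z. indicator ?Q z *\<^sub>R g (?f z))"
    by (rule borel_integrable_compact) (use gf in auto)
  then have int: "integrable lborel (\<lambda>z. g (?f z))" by (simp only: eq)
  have "integral\<^sup>L lborel (\<lambda>z. g (?f z)) = integral UNIV (\<lambda>z. g (?f z))"
    using integral_lborel[OF int] by simp
  also have "\<dots> = integral UNIV (\<lambda>z. if z \<in> ?Q then g (?f z) else 0)"
    by (rule arg_cong[where f = "integral UNIV"]) (use eq in \<open>auto simp: fun_eq_iff indicator_def split: if_splits\<close>)
  also have "\<dots> = integral ?Q (\<lambda>z. g (?f z))" by (rule integral_restrict_UNIV)
  also have "\<dots> = integral {-R..R} (\<lambda>x. integral {-R..R} (\<lambda>y. g (vector [x, y])))"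
    using integral_prod_continuous[OF gf, of "-R" "-R" R R] by (simp add: cbox_interval)
  also have "\<dots> = integral {-R..R} (\<lambda>y. integral {-R..R} (\<lambda>x. g (vector [x, y])))"
    using integral_swap_continuous[of "-R" "-R" R R "\<lambda>x y. g (vector [x, y])"] gf
    by (simp add: cbox_interval case_prod_beta)
  finally have "has_bochner_integral lborel (\<lambda>z. g (?f z)) I"
    using int I by (simp add: has_bochner_integral_iff)
  moreover have "?f \<in> borel_measurable borel" "g \<in> borel_measurable borel"
    using f g by (auto intro: borel_measurable_continuous_onI)
  ultimately show ?thesis
    by (subst lborel_vec2) (simp add: has_bochner_integral_iff integrable_distr_eq integral_distr)
qed

text \<open>Continuity of \<open>W\<close> across the axes leaves no jump of the flux there. Hence a
  divergence identity known only off the axes still integrates to 0.\<close>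

lemma weak_divergence_zero:
  fixes W :: "real^2 \<Rightarrow> real^2" and g :: "real^2 \<Rightarrow> real"
  assumes W: "continuous_on UNIV W" and g: "continuous_on UNIV g"
    and supp: "compact K" "\<And>x. x \<notin> K \<Longrightarrow> W x = 0" "\<And>x. x \<notin> K \<Longrightarrow> g x = 0"
    and diff: "\<And>x. x \<in> off_axes \<Longrightarrow> W differentiable (at x)"
    and cont1: "continuous_on off_axes (\<lambda>x. pd 1 W x $ 1)"
    and div: "\<And>x. x \<in> off_axes \<Longrightarrow> divergence W x = g x"
  shows "has_bochner_integral lborel g 0"
proof -
  obtain B where B: "\<And>x. x \<in> K \<Longrightarrow> norm x \<le> B"
    using compact_imp_bounded[OF supp(1)] bounded_iff by blast
  \<comment> \<open>Larger than every norm on \<open>K\<close>, so the fields vanish already on the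
    edges of the square.\<close>
  define R where "R = \<bar>B\<bar> + 1"
  have out: "x \<notin> K" if "R \<le> \<bar>x $ i\<bar>" for x i
    using that B[of x] component_le_norm_cart[of x i] by (auto simp: R_def)
  have vec: "continuous_on S (\<lambda>(x, y). vector [x, y] :: real^2)" for S
    by (auto simp: case_prod_beta intro!: continuous_on_vector2 continuous_intros)
  have W': "(W has_derivative frechet_derivative W (at x)) (at x)" if "x \<in> off_axes" for x
    using diff[OF that] frechet_derivative_works by blast
  have line: "((\<lambda>x. vector [x, y] :: real^2) has_vector_derivative axis 1 1) (at x)"
    "((\<lambda>y. vector [x, y] :: real^2) has_vector_derivative axis 2 1) (at y)" for x y
  proof -
    have "(\<lambda>x. vector [x, y] :: real^2) = (\<lambda>x. x *\<^sub>R axis 1 1 + y *\<^sub>R axis 2 1)" for y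
      by (auto simp: vec2_eq_iff axis_def)
    moreover have "(\<lambda>y. vector [x, y] :: real^2) = (\<lambda>y. x *\<^sub>R axis 1 1 + y *\<^sub>R axis 2 1)" for x
      by (auto simp: vec2_eq_iff axis_def)
    ultimately show "((\<lambda>x. vector [x, y] :: real^2) has_vector_derivative axis 1 1) (at x)"
      "((\<lambda>y. vector [x, y] :: real^2) has_vector_derivative axis 2 1) (at y)"
      by (auto intro!: derivative_eq_intros)
  qed
  have comp: "((\<lambda>t. W (c t) $ i) has_real_derivative pd j W (c t) $ i) (at t)"
    if "(c has_vector_derivative axis j 1) (at t)" "c t \<in> off_axes" for c j t i
  proof -
    have "((\<lambda>t. W (c t)) has_vector_derivative pd j W (c t)) (at t)"
      using vector_derivative_diff_chain_within[OF that(1), of W "frechet_derivative W (at (c t))"] W'[OF that(2)]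
      by (simp add: comp_def pd_def has_derivative_at_withinI)
    then show ?thesis
      unfolding has_real_derivative_iff_has_vector_derivative
      by (rule bounded_linear.has_vector_derivative[OF bounded_linear_vec_nth])
  qed
  show ?thesis
  proof (rule has_bochner_integral_vec2[OF g, of R])
    show "g x = 0" if "R < \<bar>x $ i\<bar>" for x i using out[of x i] supp(3) that by simp
    show "integral {-R..R} (\<lambda>y. integral {-R..R} (\<lambda>x. g (vector [x, y]))) = 0"
    proof (rule iterated_divergence_zero[where ?W1.0 = "\<lambda>x y. W (vector [x, y]) $ 1" and ?W2.0 = "\<lambda>x y. W (vector [x, y]) $ 2"
          and ?V1.0 = "\<lambda>x y. pd 1 W (vector [x, y]) $ 1"])
      show "continuous_on UNIV (\<lambda>(x, y). W (vector [x, y]) $ 1)" "continuous_on UNIV (\<lambda>(x, y). W (vector [x, y]) $ 2)"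
        "continuous_on UNIV (\<lambda>(x, y). g (vector [x, y]))"
        using continuous_on_compose2[OF W vec] continuous_on_compose2[OF g vec]
        by (auto simp: case_prod_beta intro!: continuous_on_component)
      show "0 \<le> R" by (simp add: R_def)
      have R: "R \<le> \<bar>R\<bar>" "R \<le> \<bar>- R\<bar>" by auto
      show "W (vector [R, y]) $ 1 = 0" "W (vector [- R, y]) $ 1 = 0" for y
        using out[of "vector [R, y]" 1] out[of "vector [- R, y]" 1] R by (simp_all add: supp(2))
      show "W (vector [x, R]) $ 2 = 0" "W (vector [x, - R]) $ 2 = 0" for x
        using out[of "vector [x, R]" 2] out[of "vector [x, - R]" 2] R by (simp_all add: supp(2))
      fix x y :: real assume xy: "x \<noteq> 0" "y \<noteq> 0"
      have off: "vector [x, y] \<in> off_axes" using xy unfolding off_axes_iff by simp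
      show "((\<lambda>x. W (vector [x, y]) $ 1) has_real_derivative pd 1 W (vector [x, y]) $ 1) (at x)"
        by (rule comp[OF line(1) off])
      have "g (vector [x, y]) - pd 1 W (vector [x, y]) $ 1 = pd 2 W (vector [x, y]) $ 2"
        using div[OF off] by (simp add: divergence_def sum_2)
      then show "((\<lambda>y. W (vector [x, y]) $ 2) has_real_derivative g (vector [x, y]) - pd 1 W (vector [x, y]) $ 1) (at y)"
        using comp[OF line(2) off, of 2] by simp
    next
      have "continuous_on {(x, y). x \<noteq> 0 \<and> y \<noteq> 0} (\<lambda>z. pd 1 W ((\<lambda>(x, y). vector [x, y]) z) $ 1)"
        by (rule continuous_on_compose2[OF cont1 vec]) (auto simp: axis1_def axis2_def)
      then show "continuous_on {(x, y). x \<noteq> 0 \<and> y \<noteq> 0} (\<lambda>(x, y). pd 1 W (vector [x, y]) $ 1)"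
        by (simp add: case_prod_beta)
    qed
  qed
qed

section \<open>Weak solutions and divergence\<close>

lemma Ck_on_1D:
  assumes "Ck_on 1 f S"
  shows "x \<in> S \<Longrightarrow> f differentiable (at x)" "continuous_on S (pd j f)" "continuous_on S f"
proof -
  show D: "x \<in> S \<Longrightarrow> f differentiable (at x)" for x using assms by simp
  show "continuous_on S (pd j f)" using assms by (simp add: pd_def[abs_def])
  show "continuous_on S f"
    using D differentiable_imp_continuous_within continuous_at_imp_continuous_on by blast
qed

lemma pd_outside_support:
  assumes "x \<notin> closure {x. f x \<noteq> 0}"
  shows "pd j f x = 0"
proof -
  have "((\<lambda>_. 0) has_derivative (\<lambda>_. 0)) (at x)" by simp
  then have "(f has_derivative (\<lambda>_. 0)) (at x)"
    by (rule has_derivative_transform_within_open[of _ _ _ _ "- closure {x. f x \<noteq> 0}"])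
      (use assms closure_subset[of "{x. f x \<noteq> 0}"] in auto)
  then show ?thesis by (simp add: pd_eqI)
qed

text \<open>Each weak integrand is, off the axes, the divergence of a continuous compactly supported
  field: (\<phi> . u) u + p \<phi> for the momentum equation and \<eta> u for incompressibility. The
  Euler equations cancel all remaining terms.\<close>

lemma weak_euler_if_continuous:
  assumes u: "continuous_on UNIV u" and p: "continuous_on UNIV p"
    and u1: "Ck_on 1 u off_axes" and p1: "Ck_on 1 p off_axes" and euler: "euler_on off_axes u p"
  shows "weak_euler u p"
  unfolding weak_euler_def
proof (intro conjI allI impI)
  have Du: "(u has_derivative frechet_derivative u (at x)) (at x)"
    and Dp: "(p has_derivative frechet_derivative p (at x)) (at x)" if "x \<in> off_axes" for x
    using Ck_on_1D(1)[OF u1 that] Ck_on_1D(1)[OF p1 that] frechet_derivative_works by auto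
  have u': "continuous_on S u" and p': "continuous_on S p" for S
    using u p continuous_on_subset by blast+
  {
    fix \<phi> :: "real^2 \<Rightarrow> real^2"
    assume "Ck_on 1 \<phi> UNIV \<and> compactly_supported \<phi>"
    then have \<phi>: "Ck_on 1 \<phi> UNIV" and supp: "compact (closure {x. \<phi> x \<noteq> 0})"
      by (auto simp: compactly_supported_def)
    have D\<phi>: "(\<phi> has_derivative frechet_derivative \<phi> (at x)) (at x)" for x
      using Ck_on_1D(1)[OF \<phi>] frechet_derivative_works by auto
    have \<phi>': "continuous_on S \<phi>" "continuous_on S (pd j \<phi>)" for S j
      using Ck_on_1D[OF \<phi>] continuous_on_subset by blast+
    define W where "W x = (\<phi> x \<bullet> u x) *\<^sub>R u x + p x *\<^sub>R \<phi> x" for x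
    have DW: "(W has_derivative (\<lambda>v. (\<phi> x \<bullet> u x) *\<^sub>R frechet_derivative u (at x) v
        + (\<phi> x \<bullet> frechet_derivative u (at x) v + frechet_derivative \<phi> (at x) v \<bullet> u x) *\<^sub>R u x
        + (p x *\<^sub>R frechet_derivative \<phi> (at x) v + frechet_derivative p (at x) v *\<^sub>R \<phi> x))) (at x)"
      if "x \<in> off_axes" for x
      unfolding W_def[abs_def]
      by (rule derivative_eq_intros Du[OF that] Dp[OF that] D\<phi> refl)+
    have pdW: "pd j W x = (\<phi> x \<bullet> u x) *\<^sub>R pd j u x + (\<phi> x \<bullet> pd j u x + pd j \<phi> x \<bullet> u x) *\<^sub>R u x
        + (p x *\<^sub>R pd j \<phi> x + pd j p x *\<^sub>R \<phi> x)" if "x \<in> off_axes" for x j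
      unfolding pd_eqI[OF DW[OF that]] by (simp add: pd_def)
    show "has_bochner_integral lborel (\<lambda>x. advect u \<phi> x \<bullet> u x + p x * divergence \<phi> x) 0"
    proof (rule weak_divergence_zero[where W = W, OF _ _ supp])
      show "continuous_on UNIV W"
        unfolding W_def[abs_def] by (intro continuous_intros u' p' \<phi>')
      show "continuous_on UNIV (\<lambda>x. advect u \<phi> x \<bullet> u x + p x * divergence \<phi> x)"
        unfolding advect_def divergence_def by (intro continuous_intros u' p' \<phi>')
      fix x assume x: "x \<notin> closure {x. \<phi> x \<noteq> 0}"
      then have "\<phi> x = 0" using closure_subset[of "{x. \<phi> x \<noteq> 0}"] by auto
      then show "W x = 0" by (simp add: W_def)
      show "advect u \<phi> x \<bullet> u x + p x * divergence \<phi> x = 0"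
        using pd_outside_support[OF x] by (simp add: advect_def divergence_def)
    next
      show "W differentiable (at x)" if "x \<in> off_axes" for x
        using DW[OF that] differentiable_def by blast
      have "continuous_on off_axes (\<lambda>x. ((\<phi> x \<bullet> u x) *\<^sub>R pd 1 u x + (\<phi> x \<bullet> pd 1 u x + pd 1 \<phi> x \<bullet> u x) *\<^sub>R u x
        + (p x *\<^sub>R pd 1 \<phi> x + pd 1 p x *\<^sub>R \<phi> x)) $ 1)"
        by (intro continuous_intros u' p' \<phi>' Ck_on_1D(2)[OF u1] Ck_on_1D(2)[OF p1])
      then show "continuous_on off_axes (\<lambda>x. pd 1 W x $ 1)"
        by (rule continuous_on_eq) (simp add: pdW)
      fix x assume x: "x \<in> off_axes"
      have e1: "advect u u x $ 1 = - pd 1 p x" "advect u u x $ 2 = - pd 2 p x" and e2: "divergence u x = 0"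
        using euler x by (auto simp: euler_on_def vec2_eq_iff grad_def add_eq_0_iff)
      have "divergence W x = (\<phi> x \<bullet> u x) * divergence u x + \<phi> x $ 1 * (advect u u x $ 1 + pd 1 p x)
          + \<phi> x $ 2 * (advect u u x $ 2 + pd 2 p x) + (advect u \<phi> x \<bullet> u x + p x * divergence \<phi> x)"
        by (simp add: divergence_def advect_def sum_2 pdW[OF x] inner_vec2 algebra_simps)
      then show "divergence W x = advect u \<phi> x \<bullet> u x + p x * divergence \<phi> x"
        by (simp add: e1 e2)
    qed
  next
    fix \<eta> :: "real^2 \<Rightarrow> real"
    assume "Cinf_on \<eta> UNIV \<and> compactly_supported \<eta>"
    then have \<eta>: "Ck_on 1 \<eta> UNIV" and supp: "compact (closure {x. \<eta> x \<noteq> 0})"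
      by (auto simp: compactly_supported_def Cinf_on_def simp del: Ck_on.simps One_nat_def)
    have D\<eta>: "(\<eta> has_derivative frechet_derivative \<eta> (at x)) (at x)" for x
      using Ck_on_1D(1)[OF \<eta>] frechet_derivative_works by auto
    have \<eta>': "continuous_on S \<eta>" "continuous_on S (pd j \<eta>)" for S j
      using Ck_on_1D[OF \<eta>] continuous_on_subset by blast+
    define W where "W x = \<eta> x *\<^sub>R u x" for x
    have DW: "(W has_derivative (\<lambda>v. \<eta> x *\<^sub>R frechet_derivative u (at x) v
        + frechet_derivative \<eta> (at x) v *\<^sub>R u x)) (at x)" if "x \<in> off_axes" for x
      unfolding W_def[abs_def] by (rule derivative_eq_intros Du[OF that] D\<eta> refl)+
    have pdW: "pd j W x = \<eta> x *\<^sub>R pd j u x + pd j \<eta> x *\<^sub>R u x" if "x \<in> off_axes" for x j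
      unfolding pd_eqI[OF DW[OF that]] by (simp add: pd_def)
    have g: "u x \<bullet> grad \<eta> x = u x $ 1 * pd 1 \<eta> x + u x $ 2 * pd 2 \<eta> x" for x
      by (simp add: inner_vec2 grad_def)
    show "has_bochner_integral lborel (\<lambda>x. u x \<bullet> grad \<eta> x) 0"
      unfolding g
    proof (rule weak_divergence_zero[where W = W, OF _ _ supp])
      show "continuous_on UNIV W"
        unfolding W_def[abs_def] by (intro continuous_intros u' \<eta>')
      show "continuous_on UNIV (\<lambda>x. u x $ 1 * pd 1 \<eta> x + u x $ 2 * pd 2 \<eta> x)"
        by (intro continuous_intros u' \<eta>')
      fix x assume x: "x \<notin> closure {x. \<eta> x \<noteq> 0}"
      then have "\<eta> x = 0" using closure_subset[of "{x. \<eta> x \<noteq> 0}"] by auto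
      then show "W x = 0" by (simp add: W_def)
      show "u x $ 1 * pd 1 \<eta> x + u x $ 2 * pd 2 \<eta> x = 0"
        using pd_outside_support[OF x] by simp
    next
      show "W differentiable (at x)" if "x \<in> off_axes" for x
        using DW[OF that] differentiable_def by blast
      have "continuous_on off_axes (\<lambda>x. (\<eta> x *\<^sub>R pd 1 u x + pd 1 \<eta> x *\<^sub>R u x) $ 1)"
        by (intro continuous_intros u' \<eta>' Ck_on_1D(2)[OF u1])
      then show "continuous_on off_axes (\<lambda>x. pd 1 W x $ 1)"
        by (rule continuous_on_eq) (simp add: pdW)
      fix x assume x: "x \<in> off_axes"
      have "divergence u x = 0" using euler x by (auto simp: euler_on_def)
      moreover have "divergence W x = \<eta> x * divergence u x + (u x $ 1 * pd 1 \<eta> x + u x $ 2 * pd 2 \<eta> x)"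
        by (simp add: divergence_def sum_2 pdW[OF x] algebra_simps)
      ultimately show "divergence W x = u x $ 1 * pd 1 \<eta> x + u x $ 2 * pd 2 \<eta> x" by simp
    qed
  }
qed

lemma at_within_off_axes_neq_bot: "at a within off_axes \<noteq> bot"
proof -
  have "\<exists>x\<in>off_axes. x \<noteq> a \<and> dist x a < e" if "e > 0" for e
  proof -
    \<comment> \<open>On the diagonal line through \<open>a\<close> at most two parameters meet an
      axis; a shift below e / 2 in each coordinate has length below e.\<close>
    have "infinite ({0<..<e / 2} - {- (a $ 1), - (a $ 2)})"
      using that by (intro Diff_infinite_finite) (auto simp: infinite_Ioo)
    then obtain t where "t \<in> {0<..<e / 2} - {- (a $ 1), - (a $ 2)}"
      using infinite_imp_nonempty by blast
    then have t: "0 < t" "t < e / 2" "t \<noteq> - (a $ 1)" "t \<noteq> - (a $ 2)" by auto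
    define x where "x = a + vector [t, t]"
    have "a $ 1 + t \<noteq> 0" "a $ 2 + t \<noteq> 0" using t by linarith+
    then have "x \<in> off_axes" unfolding off_axes_iff by (simp add: x_def)
    moreover have "dist x a < e"
      using norm_le_l1_cart[of "vector [t, t] :: real^2"] t by (simp add: x_def dist_norm sum_2)
    moreover have "x \<noteq> a" using t by (simp add: x_def vec2_eq_iff)
    ultimately show ?thesis by blast
  qed
  then show ?thesis by (simp add: trivial_limit_within islimpt_approachable)
qed

lemma diverges_on_axesI:
  assumes "\<And>a. a \<in> axis1 \<union> axis2 \<Longrightarrow> a \<noteq> 0 \<Longrightarrow> filterlim (\<lambda>x. \<bar>g x\<bar>) at_top (at a within off_axes)"
  shows "diverges_on_axes g"
  unfolding diverges_on_axes_def
proof (intro ballI allI impI)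
  fix a :: "real^2" and e M :: real assume "a \<in> axis1 \<union> axis2 - {0}" and e: "0 < e"
  then have "\<forall>\<^sub>F x in at a within off_axes. M < \<bar>g x\<bar>"
    using assms by (simp add: filterlim_at_top_dense)
  moreover have "\<forall>\<^sub>F x in at a within off_axes. x \<in> off_axes \<and> dist x a < e"
    using e by (auto simp: eventually_at)
  ultimately have "\<forall>\<^sub>F x in at a within off_axes. x \<in> off_axes \<and> dist x a < e \<and> M < \<bar>g x\<bar>"
    by eventually_elim auto
  then show "\<exists>x\<in>off_axes. dist x a < e \<and> \<bar>g x\<bar> > M"
    using eventually_happens at_within_off_axes_neq_bot by blast
qed

section \<open>The solutions\<close>

text \<open>Off the axes, where \<open>h (ang x) \<noteq> 0\<close>, this algebra is closed under differentiation by the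
  second-order equation for \<open>h\<close>; hence its members are smooth.\<close>

inductive flow_alg :: "(real \<Rightarrow> real) \<Rightarrow> (real \<Rightarrow> real) \<Rightarrow> (real^2 \<Rightarrow> real) \<Rightarrow> bool" for h h1
  where
    const: "flow_alg h h1 (\<lambda>x. c)"
  | coord: "flow_alg h h1 (\<lambda>x. x $ i)"
  | radial: "flow_alg h h1 (\<lambda>x. norm x powr s)"
  | profile: "flow_alg h h1 (\<lambda>x. h (ang x))"
  | slope: "flow_alg h h1 (\<lambda>x. h1 (ang x))"
  | profile_powr: "flow_alg h h1 (\<lambda>x. \<bar>h (ang x)\<bar> powr s)"
  | add: "flow_alg h h1 f \<Longrightarrow> flow_alg h h1 g \<Longrightarrow> flow_alg h h1 (\<lambda>x. f x + g x)"
  | mult: "flow_alg h h1 f \<Longrightarrow> flow_alg h h1 g \<Longrightarrow> flow_alg h h1 (\<lambda>x. f x * g x)"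

context profile
begin

definition h2 :: "real \<Rightarrow> real"
  where "h2 y = - \<mu>\<^sup>2 * h y - b * \<beta> / 2 * \<bar>h y\<bar> powr (\<beta> - 2) * h y"

lemma h_per: "h (y + pi) = h y" and h1_per: "h1 (y + pi) = h1 y"
  using h_shift[of "y + pi/2"] h_shift[of y] h1_shift[of "y + pi/2"] h1_shift[of y]
  by (simp_all add: add.assoc)

lemma h_0: "h 0 = 0"
  using h_odd[of 0] by simp

lemma h_half_pi: "h (pi / 2) = 0"
  using h_shift[of 0] h_0 by simp

lemma h_cont: "continuous_on S h"
  using DERIV_h DERIV_isCont continuous_at_imp_continuous_on by blast

lemma h_ang_neq_0:
  assumes "x \<in> off_axes"
  shows "h (ang x) \<noteq> 0"
proof (cases "0 < ang x")
  case True
  then show ?thesis using h_pos[of "ang x"] ang_off_axes[OF assms] by simp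
next
  case False
  then show ?thesis using h_pos[of "- ang x"] h_odd[of "ang x"] ang_off_axes[OF assms] by simp
qed

lemma flow_alg_diff:
  assumes "flow_alg h h1 f"
  shows "\<exists>D. (\<forall>x\<in>off_axes. (f has_derivative D x) (at x)) \<and> (\<forall>v. flow_alg h h1 (\<lambda>x. D x v))"
  using assms
proof induction
  case (const c)
  show ?case by (rule exI[of _ "\<lambda>x v. 0"]) (auto intro: flow_alg.const)
next
  case (coord i)
  show ?case by (rule exI[of _ "\<lambda>x v. v $ i"]) (auto intro: flow_alg.const has_derivative_nth2)
next
  case (radial s)
  have "((\<lambda>x. norm x powr s) has_derivative (\<lambda>v. s * norm x powr (s - 2) * (x $ 1 * v $ 1 + x $ 2 * v $ 2))) (at x)"
    if "x \<in> off_axes" for x :: "real^2"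
  proof -
    have "x \<noteq> 0" using that[unfolded off_axes_iff] by auto
    from has_derivative_norm_powr[OF this, of s] show ?thesis by (simp add: inner_vec2)
  qed
  moreover have "flow_alg h h1 (\<lambda>x. s * norm x powr (s - 2) * (x $ 1 * v $ 1 + x $ 2 * v $ 2))" for v :: "real^2"
    by (intro flow_alg.intros)
  ultimately show ?case
    by (intro exI[of _ "\<lambda>x v. s * norm x powr (s - 2) * (x $ 1 * v $ 1 + x $ 2 * v $ 2)"]) blast
next
  case profile
  have "((\<lambda>x. h (ang x)) has_derivative (\<lambda>v. h1 (ang x) * (norm x powr (-2) * (x $ 1 * v $ 2 - x $ 2 * v $ 1)))) (at x)"
    if "x \<in> off_axes" for x
    using that[unfolded off_axes_iff] by (intro has_derivative_ang_comp DERIV_h) auto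
  \<comment> \<open>The algebra is generated by sums and products, so a difference is presented with
    the constant factor \<open>- v $ 1\<close>.\<close>
  moreover have "flow_alg h h1 (\<lambda>x. h1 (ang x) * (norm x powr (-2) * (x $ 1 * v $ 2 + x $ 2 * (- v $ 1))))" for v :: "real^2"
    by (intro flow_alg.intros)
  ultimately show ?case
    by (intro exI[of _ "\<lambda>x v. h1 (ang x) * (norm x powr (-2) * (x $ 1 * v $ 2 - x $ 2 * v $ 1))"]) auto
next
  case slope
  have "((\<lambda>x. h1 (ang x)) has_derivative (\<lambda>v. h2 (ang x) * (norm x powr (-2) * (x $ 1 * v $ 2 - x $ 2 * v $ 1)))) (at x)"
    if "x \<in> off_axes" for x
    using that[unfolded off_axes_iff] DERIV_h1[OF h_ang_neq_0[OF that]]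
    by (intro has_derivative_ang_comp) (auto simp: h2_def)
  moreover have "flow_alg h h1 (\<lambda>x. ((- \<mu>\<^sup>2) * h (ang x) + (- (b * \<beta> / 2)) * \<bar>h (ang x)\<bar> powr (\<beta> - 2) * h (ang x))
      * (norm x powr (-2) * (x $ 1 * v $ 2 + x $ 2 * (- v $ 1))))" for v :: "real^2"
    by (intro flow_alg.intros)
  ultimately show ?case
    by (intro exI[of _ "\<lambda>x v. h2 (ang x) * (norm x powr (-2) * (x $ 1 * v $ 2 - x $ 2 * v $ 1))"])
      (simp add: h2_def)
next
  case (profile_powr s)
  have "((\<lambda>x. \<bar>h (ang x)\<bar> powr s) has_derivative
      (\<lambda>v. (s * \<bar>h (ang x)\<bar> powr (s - 2) * h (ang x) * h1 (ang x)) * (norm x powr (-2) * (x $ 1 * v $ 2 - x $ 2 * v $ 1)))) (at x)"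
    if "x \<in> off_axes" for x
    using that[unfolded off_axes_iff]
    by (intro has_derivative_ang_comp[where f = "\<lambda>y. \<bar>h y\<bar> powr s"]
        DERIV_chain2[where f = "\<lambda>z. \<bar>z\<bar> powr s" and g = h] DERIV_abs_powr h_ang_neq_0[OF that] DERIV_h) auto
  moreover have "flow_alg h h1 (\<lambda>x. (s * \<bar>h (ang x)\<bar> powr (s - 2) * h (ang x) * h1 (ang x))
      * (norm x powr (-2) * (x $ 1 * v $ 2 + x $ 2 * (- v $ 1))))" for v :: "real^2"
    by (intro flow_alg.intros)
  ultimately show ?case
    by (intro exI[of _ "\<lambda>x v. (s * \<bar>h (ang x)\<bar> powr (s - 2) * h (ang x) * h1 (ang x))
      * (norm x powr (-2) * (x $ 1 * v $ 2 - x $ 2 * v $ 1))"]) simp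
next
  case (add f g)
  then obtain D E where D: "\<forall>x\<in>off_axes. (f has_derivative D x) (at x)" "\<forall>v. flow_alg h h1 (\<lambda>x. D x v)"
    and E: "\<forall>x\<in>off_axes. (g has_derivative E x) (at x)" "\<forall>v. flow_alg h h1 (\<lambda>x. E x v)" by blast
  show ?case
    by (rule exI[of _ "\<lambda>x v. D x v + E x v"])
      (use D E in \<open>auto intro!: flow_alg.add has_derivative_add simp del: Compl_Un\<close>)
next
  case (mult f g)
  then obtain D E where D: "\<forall>x\<in>off_axes. (f has_derivative D x) (at x)" "\<forall>v. flow_alg h h1 (\<lambda>x. D x v)"
    and E: "\<forall>x\<in>off_axes. (g has_derivative E x) (at x)" "\<forall>v. flow_alg h h1 (\<lambda>x. E x v)" by blast
  show ?case
    by (rule exI[of _ "\<lambda>x v. f x * E x v + D x v * g x"])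
      (use D E mult.hyps in \<open>auto intro!: flow_alg.add flow_alg.mult has_derivative_mult simp del: Compl_Un\<close>)
qed

lemma Cinf_on_flow_alg:
  assumes "flow_alg h h1 f"
  shows "Cinf_on f off_axes"
  by (rule Cinf_on_coinduct[where P = "flow_alg h h1", OF open_off_axes assms flow_alg_diff])

lemma Cinf_on_flow_alg_vec:
  fixes F :: "real^2 \<Rightarrow> real^2"
  assumes "flow_alg h h1 (\<lambda>x. F x $ 1)" "flow_alg h h1 (\<lambda>x. F x $ 2)"
  shows "Cinf_on F off_axes"
proof (rule Cinf_on_coinduct[where P = "\<lambda>F. flow_alg h h1 (\<lambda>x. F x $ 1) \<and> flow_alg h h1 (\<lambda>x. F x $ 2)", OF open_off_axes])
  show "flow_alg h h1 (\<lambda>x. F x $ 1) \<and> flow_alg h h1 (\<lambda>x. F x $ 2)" using assms by simp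
  fix F :: "real^2 \<Rightarrow> real^2"
  assume F: "flow_alg h h1 (\<lambda>x. F x $ 1) \<and> flow_alg h h1 (\<lambda>x. F x $ 2)"
  obtain D where D: "\<forall>x\<in>off_axes. ((\<lambda>x. F x $ 1) has_derivative D x) (at x)" "\<forall>v. flow_alg h h1 (\<lambda>x. D x v)"
    using flow_alg_diff F by blast
  obtain E where E: "\<forall>x\<in>off_axes. ((\<lambda>x. F x $ 2) has_derivative E x) (at x)" "\<forall>v. flow_alg h h1 (\<lambda>x. E x v)"
    using flow_alg_diff F by blast
  have eq: "F = (\<lambda>x. vector [F x $ 1, F x $ 2])" by (simp add: fun_eq_iff vec2_eq_iff)
  have "(F has_derivative (\<lambda>v. vector [D x v, E x v])) (at x)" if "x \<in> off_axes" for x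
    using has_derivative_vector2[of "\<lambda>x. F x $ 1" "D x" "at x" "\<lambda>x. F x $ 2" "E x"] D(1) E(1) that
    unfolding eq[symmetric] by blast
  then show "\<exists>D. (\<forall>x\<in>off_axes. (F has_derivative D x) (at x)) \<and>
      (\<forall>v. flow_alg h h1 (\<lambda>x. D x v $ 1) \<and> flow_alg h h1 (\<lambda>x. D x v $ 2))"
    using D(2) E(2) by (intro exI[of _ "\<lambda>x v. vector [D x v, E x v]"]) simp
qed

text \<open>The profile conditions are imposed only where \<open>h\<close> is nonzero, which covers
  every angle off the axes. Since \<kappa> - 1 = - \<alpha>, velocity and pressure have the required
  degrees - \<alpha> and - 2 \<alpha>.\<close>

lemma symmetric_solution_swirl:
  assumes alg: "flow_alg h h1 (\<lambda>x. f0 (ang x))" "flow_alg h h1 (\<lambda>x. f1 (ang x))"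
    and D0: "\<And>y. h y \<noteq> 0 \<Longrightarrow> (f0 has_real_derivative f1 y) (at y)"
    and D1: "\<And>y. h y \<noteq> 0 \<Longrightarrow> (f1 has_real_derivative f2 y) (at y)"
    and momentum: "\<And>y. h y \<noteq> 0 \<Longrightarrow>
      (\<kappa> - 1) * (f1 y)\<^sup>2 - \<kappa> * f0 y * f2 y - \<kappa>\<^sup>2 * (f0 y)\<^sup>2 = - 2 * (\<kappa> - 1) * P"
    and rot: "\<And>y. h y \<noteq> 0 \<Longrightarrow> f2 y + \<kappa>\<^sup>2 * f0 y \<noteq> 0"
    and sym: "\<And>y. f0 (- y) = - f0 y" "\<And>y. f1 (- y) = f1 y" "f0 (pi / 2) = 0"
    and \<alpha>: "\<alpha> = 1 - \<kappa>"
  shows "symmetric_solution UNIV \<alpha> (swirl \<kappa> f0 f1) (radial_pressure \<kappa> P)"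
  unfolding symmetric_solution_def
proof (intro conjI)
  have swirl: "swirl_at f0 f1 (f2 (ang x)) x" if "x \<in> off_axes" for x
    by (rule swirl_at.intro) (use that h_ang_neq_0 D0 D1 in blast)+
  have "flow_alg h h1 (\<lambda>x. norm x powr (\<kappa> - 2) * ((-1) * f1 (ang x) * x $ 1 + (- \<kappa>) * f0 (ang x) * x $ 2))"
    "flow_alg h h1 (\<lambda>x. norm x powr (\<kappa> - 2) * (\<kappa> * f0 (ang x) * x $ 1 + (-1) * f1 (ang x) * x $ 2))"
    by (intro flow_alg.intros alg)+
  then show "Cinf_on (swirl \<kappa> f0 f1) off_axes"
    by (intro Cinf_on_flow_alg_vec) (simp_all add: swirl_def)
  show "Cinf_on (radial_pressure \<kappa> P) off_axes"
    unfolding radial_pressure_def[abs_def] by (intro Cinf_on_flow_alg flow_alg.intros)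
  show "euler_on off_axes (swirl \<kappa> f0 f1) (radial_pressure \<kappa> P)"
    unfolding euler_on_def
    using swirl_at.euler_swirl[OF swirl momentum[OF h_ang_neq_0]] swirl_at.divergence_swirl[OF swirl] by blast
  have "vector [1, 1] \<in> off_axes" unfolding off_axes_iff by simp
  moreover have "vorticity (swirl \<kappa> f0 f1) x \<noteq> 0" if "x \<in> off_axes" for x
  proof -
    have "x \<noteq> 0" using that[unfolded off_axes_iff] by auto
    then show ?thesis
      using rot[OF h_ang_neq_0[OF that]] by (simp add: swirl_at.vorticity_swirl[OF swirl[OF that]])
  qed
  ultimately show "rotational (swirl \<kappa> f0 f1)" unfolding rotational_def by blast
  show "homogeneous_on UNIV \<alpha> (swirl \<kappa> f0 f1) (radial_pressure \<kappa> P)"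
    unfolding homogeneous_on_def
  proof (intro ballI conjI)
    fix x :: "real^2" assume "x \<in> UNIV - {0}"
    then have n: "norm x > 0" by simp
    have e: "norm x powr (\<kappa> - 1) = norm x powr (\<kappa> - 2) * norm x"
      using n powr_add[of "norm x" "\<kappa> - 2" 1] by simp
    show "swirl \<kappa> f0 f1 x = norm x powr - \<alpha> *\<^sub>R swirl \<kappa> f0 f1 (x /\<^sub>R norm x)"
      using n by (simp add: swirl_def ang_scaleR vec2_eq_iff \<alpha> e field_simps)
    show "radial_pressure \<kappa> P x = norm x powr (- 2 * \<alpha>) * radial_pressure \<kappa> P (x /\<^sub>R norm x)"
      using n by (simp add: radial_pressure_def \<alpha> algebra_simps)
  qed
  have norm_reflect: "norm (vector [- (x $ 1), x $ 2] :: real^2) = norm x"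
    "norm (vector [x $ 1, - (x $ 2)] :: real^2) = norm x" for x :: "real^2"
    by (simp_all add: norm_vec_def L2_set_def sum_2)
  show "x1_symmetric_on UNIV (swirl \<kappa> f0 f1) (radial_pressure \<kappa> P)"
    unfolding x1_symmetric_on_def Let_def
  proof (intro ballI conjI)
    fix x :: "real^2"
    let ?y = "vector [- (x $ 1), x $ 2] :: real^2"
    \<comment> \<open>On x1 = 0 the reflection keeps \<open>ang\<close> at pi/2, so oddness says
      nothing there; the vanishing of \<open>f0\<close> at pi/2 takes its place.\<close>
    have f: "f0 (ang ?y) * x $ 1 = - f0 (ang x) * x $ 1" "f1 (ang ?y) = f1 (ang x)" "f0 (ang ?y) * x $ 2 = - f0 (ang x) * x $ 2"
      by (cases "x $ 1 = 0"; simp add: ang_reflect sym; simp add: ang_def sym)+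
    show "swirl \<kappa> f0 f1 x $ 1 = - (swirl \<kappa> f0 f1 ?y $ 1)"
      using f by (simp add: swirl_def norm_reflect right_diff_distrib distrib_left mult.assoc)
    show "swirl \<kappa> f0 f1 x $ 2 = swirl \<kappa> f0 f1 ?y $ 2"
      using f by (simp add: swirl_def norm_reflect right_diff_distrib distrib_left mult.assoc)
    show "radial_pressure \<kappa> P x = radial_pressure \<kappa> P ?y" by (simp add: radial_pressure_def norm_reflect)
  qed
  show "x2_symmetric_on UNIV (swirl \<kappa> f0 f1) (radial_pressure \<kappa> P)"
    unfolding x2_symmetric_on_def Let_def
  proof (intro ballI conjI)
    fix x :: "real^2"
    let ?y = "vector [x $ 1, - (x $ 2)] :: real^2"
    have f: "f0 (ang ?y) * x $ 1 = - f0 (ang x) * x $ 1" "f1 (ang ?y) = f1 (ang x)" "f0 (ang ?y) * x $ 2 = - f0 (ang x) * x $ 2"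
      by (cases "x $ 1 = 0"; simp add: ang_reflect sym; simp add: ang_def sym)+
    show "swirl \<kappa> f0 f1 x $ 1 = swirl \<kappa> f0 f1 ?y $ 1"
      using f by (simp add: swirl_def norm_reflect right_diff_distrib distrib_left mult.assoc)
    show "swirl \<kappa> f0 f1 x $ 2 = - (swirl \<kappa> f0 f1 ?y $ 2)"
      using f by (simp add: swirl_def norm_reflect right_diff_distrib distrib_left mult.assoc)
    show "radial_pressure \<kappa> P x = radial_pressure \<kappa> P ?y" by (simp add: radial_pressure_def norm_reflect)
  qed
qed

text \<open>The profile is nonzero off the axes and tends to 0 at their points other than the
  origin. With q = 1 - \<beta> this drives the vorticity for \<alpha> < 0, with q = 1 - \<kappa> the
  speed for \<alpha> > 0.\<close>

lemma filterlim_profile_singular: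
  assumes a: "a \<in> axis1 \<union> axis2" "a \<noteq> 0" and q: "0 < q" and c: "0 < c"
  shows "filterlim (\<lambda>x. c * norm x powr s * \<bar>h (ang x)\<bar> powr (- q)) at_top (at a within off_axes)"
proof -
  have lim: "((\<lambda>x. x) \<longlongrightarrow> a) (at a within off_axes)" by (rule tendsto_ident_at)
  have "h (ang a) = 0" using a h_0 h_half_pi by (auto simp: axis1_def axis2_def ang_def)
  moreover have "isCont (\<lambda>x. h (ang x)) a"
    using continuous_on_periodic_ang[OF h_cont h_per] a(2)
      continuous_on_eq_continuous_at[of "- {0}" "\<lambda>x. h (ang x)"] by (simp add: open_Compl)
  ultimately have "((\<lambda>x. h (ang x)) \<longlongrightarrow> 0) (at a within off_axes)"
    using isCont_def tendsto_within_subset by (metis subset_UNIV)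
  then have "((\<lambda>x. \<bar>h (ang x)\<bar>) \<longlongrightarrow> 0) (at a within off_axes)" by (rule tendsto_rabs_zero)
  then have "((\<lambda>x. \<bar>h (ang x)\<bar> powr q) \<longlongrightarrow> 0 powr q) (at a within off_axes)"
    using q by (intro tendsto_powr') auto
  moreover have "\<forall>\<^sub>F x in at a within off_axes. 0 < \<bar>h (ang x)\<bar> powr q"
    using h_ang_neq_0 unfolding eventually_at_filter by (intro always_eventually) simp
  ultimately have "filterlim (\<lambda>x. inverse (\<bar>h (ang x)\<bar> powr q)) at_top (at a within off_axes)"
    by (intro filterlim_inverse_at_top) auto
  then have 1: "filterlim (\<lambda>x. \<bar>h (ang x)\<bar> powr (- q)) at_top (at a within off_axes)"
    by (simp add: powr_minus)
  have 2: "((\<lambda>x. c * norm x powr s) \<longlongrightarrow> c * norm a powr s) (at a within off_axes)"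
    using a(2) by (intro tendsto_intros lim) auto
  show ?thesis
    by (rule filterlim_tendsto_pos_mult_at_top[OF 2 _ 1]) (use a c in auto)
qed

text \<open>The factor \<open>h y\<close> absorbs the power \<beta> - 2, so that the radial equation
  involves only h^2 and |h|^\<beta>.\<close>

lemma h_h2:
  assumes "h y \<noteq> 0"
  shows "h y * h2 y = - \<mu>\<^sup>2 * (h y)\<^sup>2 - b * \<beta> / 2 * \<bar>h y\<bar> powr \<beta>"
proof -
  have "\<bar>h y\<bar> powr \<beta> = \<bar>h y\<bar> powr (\<beta> - 2) * (h y)\<^sup>2"
    using assms powr_add[of "\<bar>h y\<bar>" "\<beta> - 2" 2] by (simp add: powr_numeral)
  then show ?thesis by (simp add: h2_def power2_eq_square algebra_simps)
qed

lemma abs_h1_le: "\<bar>h1 y\<bar> \<le> sqrt (\<mu>\<^sup>2 + b)"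
proof -
  have "\<mu>\<^sup>2 * (1 - (h y)\<^sup>2) \<le> \<mu>\<^sup>2" "b * (1 - \<bar>h y\<bar> powr \<beta>) \<le> b"
    using b_pos by (auto simp: mult_le_cancel_left1 mult_le_cancel_left2)
  then have "(h1 y)\<^sup>2 \<le> \<mu>\<^sup>2 + b" using energy[of y] by linarith
  then have "sqrt ((h1 y)\<^sup>2) \<le> sqrt (\<mu>\<^sup>2 + b)" by (rule real_sqrt_le_mono)
  then show ?thesis by simp
qed

lemma bounded_hoelder_profile:
  assumes "\<beta> \<le> 1"
  shows "bounded_hoelder \<beta> h" "bounded_hoelder \<beta> h1"
proof -
  have "\<bar>h y - h z\<bar> \<le> sqrt (\<mu>\<^sup>2 + b) * \<bar>y - z\<bar>" for y z
  proof -
    have "norm (h y - h z) \<le> sqrt (\<mu>\<^sup>2 + b) * norm (y - z)"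
      by (rule field_differentiable_bound[of UNIV h h1]) (use DERIV_h abs_h1_le in auto)
    then show ?thesis by simp
  qed
  then show "bounded_hoelder \<beta> h"
    by (intro bounded_hoelder_lipschitz[OF \<beta>_pos assms h_le_1, of "sqrt (\<mu>\<^sup>2 + b)"])
      (use b_pos in auto)
  show "bounded_hoelder \<beta> h1"
    unfolding bounded_hoelder_def using h1_hoelder[OF assms] abs_h1_le by blast
qed

end

section \<open>Polar form and continuity at the origin\<close>

lemma swirl_polar:
  assumes per: "\<And>y. f0 (y + pi) = f0 y" "\<And>y. f1 (y + pi) = f1 y" and r: "0 \<le> r"
  shows "swirl \<kappa> f0 f1 (polar r \<phi>) = (r powr (\<kappa> - 1)) *\<^sub>R
    vector [- f1 \<phi> * cos \<phi> - \<kappa> * f0 \<phi> * sin \<phi>, \<kappa> * f0 \<phi> * cos \<phi> - f1 \<phi> * sin \<phi>]"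
proof (cases "r = 0")
  case True
  then show ?thesis by (simp add: swirl_def polar_def vec2_eq_iff)
next
  case False
  then have r: "0 < r" using r by simp
  have "(norm (polar r \<phi>))\<^sup>2 = r\<^sup>2"
    unfolding norm_vec2 by (simp add: polar_def power_mult_distrib flip: distrib_left)
  then have n: "norm (polar r \<phi>) = r" using r by (simp add: power2_eq_iff_nonneg)
  have e: "r powr (\<kappa> - 1) = r powr (\<kappa> - 2) * r"
    using r powr_add[of r "\<kappa> - 2" 1] by simp
  have "swirl \<kappa> f0 f1 (polar r \<phi>) = vector
    [r powr (\<kappa> - 2) * (- f1 \<phi> * (r * cos \<phi>) - \<kappa> * f0 \<phi> * (r * sin \<phi>)),
     r powr (\<kappa> - 2) * (\<kappa> * f0 \<phi> * (r * cos \<phi>) - f1 \<phi> * (r * sin \<phi>))]"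
    unfolding swirl_def n using periodic_ang_polar[of f0, OF per(1) r] periodic_ang_polar[of f1, OF per(2) r]
    by (simp add: polar_def)
  then show ?thesis by (simp add: e vec2_eq_iff algebra_simps)
qed

lemma norm_vector2_le: "norm (vector [a, b] :: real^2) \<le> \<bar>a\<bar> + \<bar>b\<bar>"
  using norm_le_l1_cart[of "vector [a, b] :: real^2"] by (simp add: sum_2)

text \<open>The angle has no limit at the origin, but bounded profiles give |u| \<le> C
  |x|^(\<kappa> - 1), which tends to 0 for \<kappa> > 1.\<close>

lemma continuous_on_swirl:
  assumes \<kappa>: "1 < \<kappa>" and f: "continuous_on UNIV f0" "continuous_on UNIV f1"
    and per: "\<And>y. f0 (y + pi) = f0 y" "\<And>y. f1 (y + pi) = f1 y"
    and M: "\<And>y. \<bar>f0 y\<bar> \<le> M" "\<And>y. \<bar>f1 y\<bar> \<le> M"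
  shows "continuous_on UNIV (swirl \<kappa> f0 f1)"
proof -
  note c = continuous_on_periodic_ang[OF f(1) per(1)] continuous_on_periodic_ang[OF f(2) per(2)]
  have "continuous_on (- {0}) (swirl \<kappa> f0 f1)"
    unfolding swirl_def[abs_def] by (intro continuous_on_vector2 continuous_intros c) auto
  then have 1: "isCont (swirl \<kappa> f0 f1) x" if "x \<noteq> 0" for x
    using that continuous_on_eq_continuous_at[of "- {0}" "swirl \<kappa> f0 f1"] by (simp add: open_Compl)
  have z: "swirl \<kappa> f0 f1 0 = 0" by (simp add: swirl_def vec2_eq_iff)
  have bound: "norm (swirl \<kappa> f0 f1 x) \<le> 2 * (M + \<kappa> * M) * norm x powr (\<kappa> - 1)" for x
  proof (cases "x = 0")
    case False
    have e: "norm x powr (\<kappa> - 1) = norm x powr (\<kappa> - 2) * norm x"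
      using False powr_add[of "norm x" "\<kappa> - 2" 1] by simp
    have t: "\<bar>f1 (ang x) * x $ i\<bar> \<le> M * norm x" "\<bar>\<kappa> * f0 (ang x) * x $ i\<bar> \<le> \<kappa> * M * norm x" for i
      using M[of "ang x"] \<kappa> component_le_norm_cart[of x i]
      by (auto simp: abs_mult intro!: mult_mono order_trans[OF abs_ge_zero M(1)])
    have "norm (swirl \<kappa> f0 f1 x) \<le> norm x powr (\<kappa> - 2) * \<bar>- f1 (ang x) * x $ 1 - \<kappa> * f0 (ang x) * x $ 2\<bar>
        + norm x powr (\<kappa> - 2) * \<bar>\<kappa> * f0 (ang x) * x $ 1 - f1 (ang x) * x $ 2\<bar>"
      unfolding swirl_def by (rule order_trans[OF norm_vector2_le]) (simp add: abs_mult)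
    also have "\<dots> \<le> norm x powr (\<kappa> - 2) * (M * norm x + \<kappa> * M * norm x)
        + norm x powr (\<kappa> - 2) * (M * norm x + \<kappa> * M * norm x)"
      using t[of 1] t[of 2] by (intro add_mono mult_left_mono) (linarith | simp)+
    finally show ?thesis by (simp add: e algebra_simps)
  qed (simp add: z)
  have "((\<lambda>x. 2 * (M + \<kappa> * M) * norm x powr (\<kappa> - 1)) \<longlongrightarrow> 2 * (M + \<kappa> * M) * norm (0::real^2) powr (\<kappa> - 1)) (at 0)"
    using \<kappa> by (intro tendsto_intros tendsto_powr') (auto intro!: tendsto_norm_zero[OF tendsto_ident_at])
  then have "(swirl \<kappa> f0 f1 \<longlongrightarrow> 0) (at 0)"
    by (intro Lim_null_comparison[OF always_eventually[OF allI[OF bound]]]) simp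
  then have "isCont (swirl \<kappa> f0 f1) 0" by (simp add: isCont_def z)
  with 1 have "isCont (swirl \<kappa> f0 f1) x" for x by (cases "x = 0") auto
  then show ?thesis by (simp add: continuous_at_imp_continuous_on)
qed

lemma continuous_on_radial_pressure:
  assumes "1 < \<kappa>"
  shows "continuous_on UNIV (radial_pressure \<kappa> P)"
  unfolding radial_pressure_def[abs_def]
  using assms by (intro continuous_intros continuous_on_powr') auto

text \<open>Bounds the gradient from below by a quantity with a closed formula.\<close>

lemma abs_vorticity_le: "\<bar>vorticity u x\<bar> \<le> 2 * norm (jacobian u (at x))"
proof -
  have "pd j u x $ i = jacobian u (at x) $ i $ j" for i j
    by (simp add: jacobian_def matrix_def pd_def)
  moreover have "\<bar>jacobian u (at x) $ i $ j\<bar> \<le> norm (jacobian u (at x))" for i j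
    using component_le_norm_cart[of "jacobian u (at x) $ i" j] Finite_Cartesian_Product.norm_nth_le[of "jacobian u (at x)" i]
    by linarith
  ultimately have "\<bar>pd j u x $ i\<bar> \<le> norm (jacobian u (at x))" for i j by metis
  from this[of 1 2] this[of 2 1] show ?thesis unfolding vorticity_def by linarith
qed

lemma solution_continuous:
  fixes \<alpha> :: real
  assumes \<alpha>: "-1 < \<alpha>" "\<alpha> < 0"
  shows "\<exists>u p. symmetric_solution UNIV \<alpha> u p \<and> continuous_on UNIV u \<and> continuous_on UNIV p \<and>
    weak_euler u p \<and> diverges_on_axes (\<lambda>x. norm (u x) + norm (jacobian u (at x))) \<and>
    polar_holder \<alpha> u (- \<alpha>) (2 + 2 / (\<alpha> - 1))"
proof -
  define \<kappa> where "\<kappa> = 1 - \<alpha>"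
  define \<beta> where "\<beta> = 2 - 2 / \<kappa>"
  have \<kappa>: "1 < \<kappa>" "\<kappa> < 2" using \<alpha> by (auto simp: \<kappa>_def)
  \<comment> \<open>The last relation makes the |h|^\<beta> terms cancel in the radial
    equation.\<close>
  have \<beta>: "0 < \<beta>" "\<beta> < 1" and \<kappa>\<beta>: "\<kappa> * \<beta> = 2 * (\<kappa> - 1)"
    using \<kappa> by (auto simp: \<beta>_def field_simps)
  have \<beta>': "2 + 2 / (\<alpha> - 1) = \<beta>" using \<alpha> by (simp add: \<beta>_def \<kappa>_def field_simps)
  obtain b h h1 where "profile \<kappa> \<beta> b h h1"
    using profile_exists[of \<kappa> \<beta>] \<kappa> \<beta> by auto
  then interpret profile \<kappa> \<beta> b h h1 .
  define u where "u = swirl \<kappa> h h1"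
  \<comment> \<open>What remains of the radial equation is the constant (\<kappa> - 1) (\<kappa>^2 +
    b), which has to equal -2 (\<kappa> - 1) P.\<close>
  define P where "P = - (\<kappa>\<^sup>2 + b) / 2"
  define p where "p = radial_pressure \<kappa> P"
  \<comment> \<open>The angular factor of the vorticity, of exact order |h|^(\<beta> - 1): nonzero
    off the axes and unbounded at them.\<close>
  have h2_plus: "h2 y + \<kappa>\<^sup>2 * h y = - (b * \<beta> / 2 * (\<bar>h y\<bar> powr (\<beta> - 2) * h y))" for y
    by (simp add: h2_def)
  have sol: "symmetric_solution UNIV \<alpha> u p"
    unfolding u_def p_def
  proof (rule symmetric_solution_swirl[where ?f2.0 = h2])
    fix y assume y: "h y \<noteq> 0"
    show "(h has_real_derivative h1 y) (at y)" by (rule DERIV_h)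
    show "(h1 has_real_derivative h2 y) (at y)" using DERIV_h1[OF y] by (simp add: h2_def)
    have "(\<kappa> - 1) * (h1 y)\<^sup>2 - \<kappa> * h y * h2 y - \<kappa>\<^sup>2 * (h y)\<^sup>2
      = (\<kappa> - 1) * (h1 y)\<^sup>2 - \<kappa> * (h y * h2 y) - \<kappa>\<^sup>2 * (h y)\<^sup>2" by (simp add: mult.assoc)
    also have "\<dots> = (\<kappa> - 1) * (\<kappa>\<^sup>2 * (1 - (h y)\<^sup>2) + b * (1 - \<bar>h y\<bar> powr \<beta>))
        + \<kappa> * \<kappa>\<^sup>2 * (h y)\<^sup>2 + (\<kappa> * \<beta>) * (b / 2 * \<bar>h y\<bar> powr \<beta>) - \<kappa>\<^sup>2 * (h y)\<^sup>2"
      unfolding energy h_h2[OF y] by (simp add: algebra_simps)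
    also have "\<dots> = - 2 * (\<kappa> - 1) * P"
      unfolding \<kappa>\<beta> P_def by (simp add: field_simps)
    finally show "(\<kappa> - 1) * (h1 y)\<^sup>2 - \<kappa> * h y * h2 y - \<kappa>\<^sup>2 * (h y)\<^sup>2 = - 2 * (\<kappa> - 1) * P" .
    show "h2 y + \<kappa>\<^sup>2 * h y \<noteq> 0" unfolding h2_plus using y b_pos \<beta> by simp
  qed (auto intro: flow_alg.intros simp: h_odd h1_even h_half_pi \<kappa>_def)
  have ub: "continuous_on UNIV u"
    unfolding u_def
    by (rule continuous_on_swirl[OF \<kappa>(1) h_cont h1_cont h_per h1_per, of "max 1 (sqrt (\<kappa>\<^sup>2 + b))"])
      (use h_le_1 abs_h1_le in \<open>auto simp: le_max_iff_disj\<close>)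
  have pb: "continuous_on UNIV p"
    unfolding p_def by (rule continuous_on_radial_pressure[OF \<kappa>(1)])
  have weak: "weak_euler u p"
    using sol unfolding symmetric_solution_def Cinf_on_def
    by (intro weak_euler_if_continuous ub pb) blast+
  have div: "diverges_on_axes (\<lambda>x. norm (u x) + norm (jacobian u (at x)))"
  proof (rule diverges_on_axesI)
    fix a :: "real^2" assume a: "a \<in> axis1 \<union> axis2" "a \<noteq> 0"
    \<comment> \<open>The vorticity has the coefficient b \<beta> / 2, of which the bound by twice
      the norm of the Jacobian leaves one half.\<close>
    have lim: "filterlim (\<lambda>x. b * \<beta> / 4 * norm x powr (\<kappa> - 2) * \<bar>h (ang x)\<bar> powr (- (1 - \<beta>))) at_top (at a within off_axes)"
      using b_pos \<beta> by (intro filterlim_profile_singular a) auto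
    have bound: "b * \<beta> / 4 * norm x powr (\<kappa> - 2) * \<bar>h (ang x)\<bar> powr (- (1 - \<beta>))
        \<le> \<bar>norm (u x) + norm (jacobian u (at x))\<bar>" if x: "x \<in> off_axes" for x
    proof -
      have h: "h (ang x) \<noteq> 0" by (rule h_ang_neq_0[OF x])
      interpret swirl_at \<kappa> h h1 "h2 (ang x)" x
        by unfold_locales (use x DERIV_h DERIV_h1[OF h] in \<open>auto simp: h2_def simp del: Compl_Un\<close>)
      have "\<bar>h (ang x)\<bar> powr (\<beta> - 1) = \<bar>h (ang x)\<bar> powr (\<beta> - 2) * \<bar>h (ang x)\<bar>"
        using h powr_add[of "\<bar>h (ang x)\<bar>" "\<beta> - 2" 1] by simp
      then have "\<bar>vorticity u x\<bar> = 2 * (b * \<beta> / 4 * norm x powr (\<kappa> - 2) * \<bar>h (ang x)\<bar> powr (\<beta> - 1))"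
        unfolding u_def vorticity_swirl h2_plus using b_pos \<beta> by (simp add: abs_mult)
      then have "b * \<beta> / 4 * norm x powr (\<kappa> - 2) * \<bar>h (ang x)\<bar> powr (\<beta> - 1) \<le> norm (jacobian u (at x))"
        using abs_vorticity_le[of u x] by linarith
      moreover have "- (1 - \<beta>) = \<beta> - 1" by simp
      ultimately show ?thesis using norm_ge_zero[of "u x"] by (simp only:)
    qed
    show "filterlim (\<lambda>x. \<bar>norm (u x) + norm (jacobian u (at x))\<bar>) at_top (at a within off_axes)"
      by (rule filterlim_at_top_mono[OF lim], unfold eventually_at_filter)
        (intro always_eventually allI impI bound)
  qed
  have "polar_holder \<alpha> u (- \<alpha>) \<beta>"
    unfolding polar_holder_def
  proof (intro exI conjI allI impI)
    \<comment> \<open>Spelled out as sums of products with constant factors, to which the closure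
      rules of \<open>bounded_hoelder\<close> apply.\<close>
    define U1 U2 where "U1 = (\<lambda>\<phi>. (- 1) * h1 \<phi> * cos \<phi> + (- \<kappa>) * h \<phi> * sin \<phi>)"
      and "U2 = (\<lambda>\<phi>. \<kappa> * h \<phi> * cos \<phi> + (- 1) * h1 \<phi> * sin \<phi>)"
    let ?U = "\<lambda>\<phi>. vector [U1 \<phi>, U2 \<phi>] :: real^2"
    show "u (polar r \<phi>) = r powr (- \<alpha>) *\<^sub>R ?U \<phi>" if "0 \<le> r" for r \<phi>
      using swirl_polar[where ?f0.0 = h and ?f1.0 = h1, OF h_per h1_per that, of \<kappa> \<phi>] by (simp add: u_def U1_def U2_def \<kappa>_def vec2_eq_iff algebra_simps)
    show "holder_on (- \<alpha>) {0..} (\<lambda>r. r powr (- \<alpha>))"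
      unfolding holder_on_def using \<alpha> abs_powr_diff_le[of _ _ "- \<alpha>"]
      by (auto simp: dist_real_def intro!: exI[of _ 1])
    have trig: "bounded_hoelder \<beta> sin" "bounded_hoelder \<beta> cos" "bounded_hoelder \<beta> (\<lambda>_. c)" for c
      using \<beta> bounded_hoelder_lipschitz[of \<beta> sin 1 1] bounded_hoelder_lipschitz[of \<beta> cos 1 1]
        bounded_hoelder_lipschitz[of \<beta> "\<lambda>_. c" "\<bar>c\<bar>" 0] sin_lipschitz cos_lipschitz by auto
    note prof = bounded_hoelder_profile[OF less_imp_le[OF \<beta>(2)]]
    have "bounded_hoelder \<beta> U1" "bounded_hoelder \<beta> U2"
      unfolding U1_def U2_def by (intro bounded_hoelder_add bounded_hoelder_mult trig prof)+
    then obtain C D where C: "\<And>x y. \<bar>U1 x - U1 y\<bar> \<le> C * \<bar>x - y\<bar> powr \<beta>"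
      and D: "\<And>x y. \<bar>U2 x - U2 y\<bar> \<le> D * \<bar>x - y\<bar> powr \<beta>"
      unfolding bounded_hoelder_def by blast
    have "dist (?U x) (?U y) \<le> (C + D) * dist x y powr \<beta>" for x y
    proof -
      have "?U x - ?U y = vector [U1 x - U1 y, U2 x - U2 y]" by (simp add: vec2_eq_iff)
      then have "dist (?U x) (?U y) \<le> \<bar>U1 x - U1 y\<bar> + \<bar>U2 x - U2 y\<bar>"
        using norm_vector2_le by (simp add: dist_norm)
      also have "\<dots> \<le> (C + D) * dist x y powr \<beta>"
        using C[of x y] D[of x y] by (simp add: dist_real_def distrib_right)
      finally show ?thesis .
    qed
    then show "holder_on \<beta> UNIV ?U"
      unfolding holder_on_def using \<beta> by auto
  qed
  with sol ub pb weak div show ?thesis unfolding \<beta>' by blast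
qed

text \<open>The formula makes sense on the whole plane because \<open>0 powr (\<kappa> - 1)\<close>
  is 0, which gives velocity 0 on the axes; homogeneity and both reflections therefore hold there
  too.\<close>

lemma solution_singular:
  fixes \<alpha> :: real
  assumes \<alpha>: "0 < \<alpha>" "\<alpha> < 1"
  shows "\<exists>u p. symmetric_solution UNIV \<alpha> u p \<and> diverges_on_axes (\<lambda>x. norm (u x))"
proof -
  define \<kappa> where "\<kappa> = 1 - \<alpha>"
  \<comment> \<open>For this exponent |h|^(2 \<kappa> - 2) |h|^\<beta> = 1 off the zeros of
    \<open>h\<close>, so the rough term of the energy becomes the constant balanced by the
    pressure.\<close>
  define \<beta> where "\<beta> = 2 * (1 - \<kappa>)"
  have \<kappa>: "0 < \<kappa>" "\<kappa> < 1" using \<alpha> by (auto simp: \<kappa>_def)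
  have \<beta>: "0 < \<beta>" "\<beta> < 2" using \<kappa> by (auto simp: \<beta>_def)
  obtain b h h1 where "profile 1 \<beta> b h h1"
    using profile_exists[of 1 \<beta>] \<beta> by auto
  then interpret profile 1 \<beta> b h h1 .
  define f0 where "f0 y = \<bar>h y\<bar> powr (\<kappa> - 1) * h y" for y
  define f1 where "f1 y = \<kappa> * (\<bar>h y\<bar> powr (\<kappa> - 1) * h1 y)" for y
  define f2 where "f2 y = \<kappa> * ((\<kappa> - 1) * \<bar>h y\<bar> powr (\<kappa> - 3) * h y * (h1 y)\<^sup>2 + \<bar>h y\<bar> powr (\<kappa> - 1) * h2 y)" for y
  \<comment> \<open>The radial equation reduces to the constant \<kappa>^2 b \<beta> / 2 =
    \<kappa>^2 b (1 - \<kappa>), which has to equal 2 (1 - \<kappa>) P.\<close>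
  define P where "P = \<kappa>\<^sup>2 * b / 2"
  define u where "u = swirl \<kappa> f0 f1"
  have powr_step: "\<bar>h y\<bar> powr (s + 2) = \<bar>h y\<bar> powr s * (h y)\<^sup>2" if "h y \<noteq> 0" for s y
    using that by (simp add: powr_add powr_numeral)
  have Dpow: "((\<lambda>y. \<bar>h y\<bar> powr (\<kappa> - 1)) has_real_derivative (\<kappa> - 1) * \<bar>h y\<bar> powr (\<kappa> - 3) * h y * h1 y) (at y)"
    if "h y \<noteq> 0" for y
    using DERIV_chain2[where f = "\<lambda>z. \<bar>z\<bar> powr (\<kappa> - 1)" and g = h, OF DERIV_abs_powr[OF that] DERIV_h] by simp
  have e1: "\<bar>h y\<bar> powr (\<kappa> - 1) = \<bar>h y\<bar> powr (\<kappa> - 3) * (h y)\<^sup>2" if "h y \<noteq> 0" for y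
    using powr_step[OF that, of "\<kappa> - 3"] by simp
  \<comment> \<open>The squared velocity on the unit circle. As |h| \<le> 1, the last factor is at
    least 1, which leaves the lower bound \<kappa>^2 |h|^(2 \<kappa> - 2).\<close>
  have speed: "(f1 y)\<^sup>2 + \<kappa>\<^sup>2 * (f0 y)\<^sup>2 = \<kappa>\<^sup>2 * (\<bar>h y\<bar> powr (\<kappa> - 1))\<^sup>2 * (1 + b * (1 - \<bar>h y\<bar> powr \<beta>))" for y
  proof -
    have "(f1 y)\<^sup>2 + \<kappa>\<^sup>2 * (f0 y)\<^sup>2 = \<kappa>\<^sup>2 * (\<bar>h y\<bar> powr (\<kappa> - 1))\<^sup>2 * ((h1 y)\<^sup>2 + (h y)\<^sup>2)"
      by (simp add: f0_def f1_def power_mult_distrib algebra_simps)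
    then show ?thesis by (simp add: energy)
  qed
  have sol: "symmetric_solution UNIV \<alpha> u (radial_pressure \<kappa> P)"
    unfolding u_def
  proof (rule symmetric_solution_swirl[where ?f2.0 = f2])
    show "flow_alg h h1 (\<lambda>x. f0 (ang x))" "flow_alg h h1 (\<lambda>x. f1 (ang x))"
      unfolding f0_def f1_def by (intro flow_alg.intros)+
    fix y assume y: "h y \<noteq> 0"
    show "(f0 has_real_derivative f1 y) (at y)"
      unfolding f0_def[abs_def]
      by (rule DERIV_cong[OF DERIV_mult[OF Dpow[OF y] DERIV_h]])
        (simp add: f1_def e1[OF y] power2_eq_square algebra_simps)
    have Dh1: "(h1 has_real_derivative h2 y) (at y)" using DERIV_h1[OF y] by (simp add: h2_def)
    show "(f1 has_real_derivative f2 y) (at y)"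
      unfolding f1_def[abs_def]
      by (rule DERIV_cong[OF DERIV_cmult[OF DERIV_mult[OF Dpow[OF y] Dh1]]])
        (simp add: f2_def power2_eq_square algebra_simps)
    define A where "A = \<bar>h y\<bar> powr (\<kappa> - 3)"
    have A: "\<bar>h y\<bar> powr (\<kappa> - 1) = A * (h y)\<^sup>2" "A \<noteq> 0" using e1[OF y] y by (auto simp: A_def)
    have AX: "(A * (h y)\<^sup>2)\<^sup>2 * \<bar>h y\<bar> powr \<beta> = 1"
    proof -
      have "\<bar>h y\<bar> powr (\<kappa> - 1) * \<bar>h y\<bar> powr (\<kappa> - 1) * \<bar>h y\<bar> powr \<beta> = \<bar>h y\<bar> powr ((\<kappa> - 1) + (\<kappa> - 1) + \<beta>)"
        by (simp only: powr_add)
      then show ?thesis using y by (simp add: \<beta>_def A(1) power2_eq_square)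
    qed
    have hh2: "h y * h2 y = - (h y)\<^sup>2 - b * \<beta> / 2 * \<bar>h y\<bar> powr \<beta>" using h_h2[OF y] by simp
    have "(\<kappa> - 1) * (f1 y)\<^sup>2 - \<kappa> * f0 y * f2 y - \<kappa>\<^sup>2 * (f0 y)\<^sup>2
        = - \<kappa>\<^sup>2 * (A * (h y)\<^sup>2)\<^sup>2 * (h y * h2 y + (h y)\<^sup>2)"
      unfolding f0_def f1_def f2_def A(1) A_def[symmetric] by (simp add: power2_eq_square algebra_simps)
    also have "\<dots> = \<kappa>\<^sup>2 * (b * \<beta> / 2) * ((A * (h y)\<^sup>2)\<^sup>2 * \<bar>h y\<bar> powr \<beta>)"
      unfolding hh2 by (simp add: algebra_simps)
    also have "\<dots> = \<kappa>\<^sup>2 * (b * \<beta> / 2)" by (simp only: AX mult_1_right)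
    also have "\<dots> = - 2 * (\<kappa> - 1) * P" by (simp add: P_def \<beta>_def field_simps)
    finally show "(\<kappa> - 1) * (f1 y)\<^sup>2 - \<kappa> * f0 y * f2 y - \<kappa>\<^sup>2 * (f0 y)\<^sup>2 = - 2 * (\<kappa> - 1) * P" .
    \<comment> \<open>After multiplication by \<open>h y\<close> the bracket is a sum of terms of
      one sign, because \<kappa> < 1, and the term with \<open>b\<close> is nonzero.\<close>
    have "(f2 y + \<kappa>\<^sup>2 * f0 y) * h y = \<kappa> * A * (h y)\<^sup>2 * ((\<kappa> - 1) * (h1 y)\<^sup>2 + h y * h2 y + \<kappa> * (h y)\<^sup>2)"
      unfolding f0_def f2_def A(1) A_def[symmetric] by (simp add: power2_eq_square algebra_simps)
    also have "\<dots> = - \<kappa> * A * (h y)\<^sup>2 * ((1 - \<kappa>) * (h1 y)\<^sup>2 + (1 - \<kappa>) * (h y)\<^sup>2 + b * \<beta> / 2 * \<bar>h y\<bar> powr \<beta>)"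
      unfolding hh2 by (simp add: algebra_simps)
    also have "\<dots> \<noteq> 0"
    proof -
      have "0 < (1 - \<kappa>) * (h1 y)\<^sup>2 + (1 - \<kappa>) * (h y)\<^sup>2 + b * \<beta> / 2 * \<bar>h y\<bar> powr \<beta>"
        using \<kappa> b_pos \<beta> y by (intro add_nonneg_pos add_nonneg_nonneg mult_pos_pos mult_nonneg_nonneg) auto
      then show ?thesis using \<kappa> A(2) y by simp
    qed
    finally show "f2 y + \<kappa>\<^sup>2 * f0 y \<noteq> 0" by auto
  qed (auto simp: f0_def f1_def h_odd h1_even h_half_pi \<kappa>_def)
  have "diverges_on_axes (\<lambda>x. norm (u x))"
  proof (rule diverges_on_axesI)
    fix a :: "real^2" assume a: "a \<in> axis1 \<union> axis2" "a \<noteq> 0"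
    have lim: "filterlim (\<lambda>x. \<kappa> * norm x powr (\<kappa> - 1) * \<bar>h (ang x)\<bar> powr (- (1 - \<kappa>))) at_top (at a within off_axes)"
      using \<kappa> by (intro filterlim_profile_singular a) auto
    have bound: "\<kappa> * norm x powr (\<kappa> - 1) * \<bar>h (ang x)\<bar> powr (- (1 - \<kappa>)) \<le> \<bar>norm (u x)\<bar>"
      if x: "x \<in> off_axes" for x
    proof -
      have "x \<noteq> 0" using x[unfolded off_axes_iff] by auto
      then have e: "norm x powr (\<kappa> - 1) = norm x powr (\<kappa> - 2) * norm x"
        using powr_add[of "norm x" "\<kappa> - 2" 1] by simp
      have "\<bar>h (ang x)\<bar> powr \<beta> \<le> 1" using h_le_1 \<beta> by (intro powr_le1) auto
      then have ge1: "1 \<le> 1 + b * (1 - \<bar>h (ang x)\<bar> powr \<beta>)" using b_pos by simp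
      have "(\<kappa> * norm x powr (\<kappa> - 1) * \<bar>h (ang x)\<bar> powr (\<kappa> - 1))\<^sup>2
          = (norm x powr (\<kappa> - 1))\<^sup>2 * (\<kappa>\<^sup>2 * (\<bar>h (ang x)\<bar> powr (\<kappa> - 1))\<^sup>2 * 1)"
        by (simp add: power_mult_distrib)
      also have "\<dots> \<le> (norm x powr (\<kappa> - 1))\<^sup>2 * ((f1 (ang x))\<^sup>2 + \<kappa>\<^sup>2 * (f0 (ang x))\<^sup>2)"
        unfolding speed using ge1 by (intro mult_left_mono) auto
      also have "\<dots> = (norm x powr (\<kappa> - 2))\<^sup>2 * ((f1 (ang x))\<^sup>2 + \<kappa>\<^sup>2 * (f0 (ang x))\<^sup>2) * ((x $ 1)\<^sup>2 + (x $ 2)\<^sup>2)"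
        unfolding e power_mult_distrib norm_vec2 by (simp add: algebra_simps)
      also have "\<dots> = (norm (u x))\<^sup>2"
        by (simp only: norm_vec2[of "u x"]) (simp add: u_def swirl_def power2_eq_square algebra_simps)
      finally have "\<kappa> * norm x powr (\<kappa> - 1) * \<bar>h (ang x)\<bar> powr (\<kappa> - 1) \<le> norm (u x)"
        by (rule power2_le_imp_le) simp
      then show ?thesis by simp
    qed
    show "filterlim (\<lambda>x. \<bar>norm (u x)\<bar>) at_top (at a within off_axes)"
      by (rule filterlim_at_top_mono[OF lim], unfold eventually_at_filter)
        (intro always_eventually allI impI bound)
  qed
  with sol show ?thesis by blast
qed

theorem theorem1p6:
  shows "(\<forall>\<alpha>::real. -1 < \<alpha> \<and> \<alpha> < 0 \<longrightarrow>
            (\<exists>(u::real^2 \<Rightarrow> real^2) (p::real^2 \<Rightarrow> real).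
               symmetric_solution UNIV \<alpha> u p \<and>
               continuous_on UNIV u \<and> continuous_on UNIV p \<and>
               weak_euler u p \<and>
               diverges_on_axes (\<lambda>x. norm (u x) + norm (jacobian u (at x))) \<and>
               polar_holder \<alpha> u (- \<alpha>) (2 + 2 / (\<alpha> - 1)))) \<and>
         (\<forall>\<alpha>::real. 0 < \<alpha> \<and> \<alpha> < 1 \<longrightarrow>
            (\<exists>(u::real^2 \<Rightarrow> real^2) (p::real^2 \<Rightarrow> real).
               symmetric_solution off_axes \<alpha> u p \<and>
               diverges_on_axes (\<lambda>x. norm (u x))))"
proof (intro conjI allI impI)
  fix \<alpha> :: real assume "0 < \<alpha> \<and> \<alpha> < 1"
  then obtain u p where "symmetric_solution UNIV \<alpha> u p" "diverges_on_axes (\<lambda>x. norm (u x))"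
    using solution_singular by blast
  moreover from this(1) have "symmetric_solution off_axes \<alpha> u p"
    unfolding symmetric_solution_def homogeneous_on_def x1_symmetric_on_def x2_symmetric_on_def by blast
  ultimately show "\<exists>u p. symmetric_solution off_axes \<alpha> u p \<and> diverges_on_axes (\<lambda>x. norm (u x))"
    by blast
qed (use solution_continuous in blast)

end
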